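(* Let $\gamma<1$ and let $X=x_1x_2\ldots$ be an infinite bit sequence whose effective Hausdorff dimension is at least $\gamma$. Let $(\delta_n)_{n\ge1}$ be a sequence of positive reals with $\lim_{n\to\infty}\delta_n=0$. Then there exists an infinite bit sequence $X'=x'_1x'_2\ldots$ such that: (1) the Besicovitch distance between $X$ and $X'$ is $0$; (2) $\mathrm{C}(x'_1\ldots x'_n)\ge n(\gamma+\delta_n)$ for all sufficiently large $n$.
   Context: $\mathrm{C}(x)$ denotes the plain Kolmogorov complexity of the binary string $x$ (minimal length of a program producing $x$ for a fixed optimal programming language). The effective Hausdorff dimension of an infinite bit sequence $X=x_1x_2\ldots$ is $\liminf_{n\to\infty}\mathrm{C}(x_1\ldots x_n)/n$. The Besicovitch distance between $X=x_1x_2\ldots$ and $Y=y_1y_2\ldots$ is $\limsup_{n\to\infty} d(x_1\ldots x_n,y_1\ldots y_n)/n$, where $d$ is the Hamming distance (number of positions where the strings differ). *)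

theory Defs
  imports Complex_Main "HOL-Library.Extended_Nat" "HOL-Library.Extended_Real"
begin

datatype recf =
    Zero
  | Succ
  | Proj nat
  | Comp recf "recf list"
  | PrimRec recf recf
  | Mu recf

text \<open>
  \<open>computes f xs y\<close>: the scheme \<open>f\<close> halts on the argument tuple \<open>xs\<close> with value \<open>y\<close>.
  Schemes carry no arity annotation; \<open>Zero\<close> accepts every tuple, \<open>Proj i\<close> every tuple longer
  than \<open>i\<close>, and a scheme applied to a tuple of unsuitable length is undefined there.
  The arity of the outermost call determines the arity of every nested call, so for each fixed arity one obtains exactly the usual partial recursive functions.
  In \<open>Mu\<close> the search requires all earlier values to be defined and nonzero.
\<close>

inductive computes :: "recf \<Rightarrow> nat list \<Rightarrow> nat \<Rightarrow> bool" where
  Zero: "computes Zero xs 0"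
| Succ: "computes Succ [x] (Suc x)"
| Proj: "i < length xs \<Longrightarrow> computes (Proj i) xs (xs ! i)"
| Comp: "list_all2 (\<lambda>g y. computes g xs y) gs ys \<Longrightarrow> computes f ys z
    \<Longrightarrow> computes (Comp f gs) xs z"
| PrimRec_0: "computes f xs y \<Longrightarrow> computes (PrimRec f g) (0 # xs) y"
| PrimRec_Suc: "computes (PrimRec f g) (n # xs) y \<Longrightarrow> computes g (n # y # xs) z
    \<Longrightarrow> computes (PrimRec f g) (Suc n # xs) z"
| Mu: "computes f (n # xs) 0 \<Longrightarrow> (\<forall>m<n. \<exists>y>0. computes f (m # xs) y)
    \<Longrightarrow> computes (Mu f) xs n"

inductive_cases computesE:
  "computes Zero xs z" "computes Succ xs z" "computes (Proj i) xs z"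
  "computes (Comp f gs) xs z" "computes (PrimRec f g) (0 # xs) z"
  "computes (PrimRec f g) (Suc n # xs) z" "computes (Mu f) xs z"

lemma computes_deterministic: "computes f xs y \<Longrightarrow> computes f xs z \<Longrightarrow> y = z"
proof (induction arbitrary: z rule: computes.induct)
  case (Comp xs gs ys f z')
  from Comp.prems obtain ys' where ys': "list_all2 (\<lambda>g y. computes g xs y) gs ys'"
    and f: "computes f ys' z" by (elim computesE)
  have "ys = ys'"
  proof (rule nth_equalityI)
    show "length ys = length ys'"
      using Comp.IH(1) ys' by (simp add: list_all2_conv_all_nth)
    show "ys ! i = ys' ! i" if "i < length ys" for i
      using Comp.IH(1) ys' that unfolding list_all2_conv_all_nth by metis
  qed
  with Comp.IH(2) f show ?case by simp
next
  case (PrimRec_Suc f g n xs y z')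
  from PrimRec_Suc.prems obtain y' where
    "computes (PrimRec f g) (n # xs) y'" "computes g (n # y' # xs) z" by (elim computesE)
  with PrimRec_Suc.IH show ?case by metis
next
  case (Mu f n xs)
  from Mu.prems have z: "computes f (z # xs) 0" "\<forall>m<z. \<exists>y>0. computes f (m # xs) y"
    by (auto elim: computesE(7))
  have "\<not> n < z" using z(2) Mu.IH(1) by (metis less_irrefl)
  moreover have "\<not> z < n" using z(1) Mu.IH(2) by (metis less_irrefl)
  ultimately show ?case by simp
qed (elim computesE; simp)+

text \<open>Bijective base-2 numeration, least significant digit first.\<close>

fun str_code :: "bool list \<Rightarrow> nat" where
  "str_code [] = 0"
| "str_code (b # bs) = 2 * str_code bs + (if b then 2 else 1)"

lemma bij_str_code: "bij str_code"
proof (rule bijI)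
  have "str_code xs = str_code ys \<Longrightarrow> xs = ys" for xs ys
  proof (induction xs arbitrary: ys)
    case Nil
    then show ?case by (cases ys) (auto split: if_splits)
  next
    case (Cons b bs)
    show ?case
    proof (cases ys)
      case Nil
      with Cons.prems show ?thesis by (auto split: if_splits)
    next
      case (Cons c cs)
      with Cons.prems have "2 * str_code bs + (if b then 2 else 1)
          = 2 * str_code cs + (if c then 2 else 1)" by simp
      then have "b = c \<and> str_code bs = str_code cs"
        by (cases b; cases c; simp; presburger)
      with Cons.IH Cons show ?thesis by simp
    qed
  qed
  then show "inj str_code" by (auto intro: injI)
  have "\<exists>xs. str_code xs = n" for n
  proof (induction n rule: less_induct)
    case (less n)
    consider "n = 0" | k where "n = 2 * k + 1" | k where "n = 2 * k + 2"
    proof -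
      have "n = 0 \<or> (\<exists>k. n = 2 * k + 1) \<or> (\<exists>k. n = 2 * k + 2)" by presburger
      then show thesis using that by blast
    qed
    then show ?case
    proof cases
      case 1
      then have "str_code [] = n" by simp
      then show ?thesis ..
    next
      case (2 k)
      then obtain xs where "str_code xs = k" using less[of k] by auto
      with 2 have "str_code (False # xs) = n" by simp
      then show ?thesis ..
    next
      case (3 k)
      then obtain xs where "str_code xs = k" using less[of k] by auto
      with 3 have "str_code (True # xs) = n" by simp
      then show ?thesis ..
    qed
  qed
  then show "surj str_code" by (metis surjI)
qed

definition partial_computable :: "(bool list \<rightharpoonup> bool list) \<Rightarrow> bool" where
  "partial_computable V \<longleftrightarrow>
     (\<exists>f. \<forall>p x. V p = Some x \<longleftrightarrow> computes f [str_code p] (str_code x))"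

text \<open>The value is \<open>\<infinity>\<close> if no program of \<open>V\<close> produces \<open>x\<close>.\<close>

definition complexity :: "(bool list \<rightharpoonup> bool list) \<Rightarrow> bool list \<Rightarrow> enat" where
  "complexity V x = (INF p \<in> {p. V p = Some x}. enat (length p))"

definition optimal :: "(bool list \<rightharpoonup> bool list) \<Rightarrow> bool" where
  "optimal U \<longleftrightarrow> partial_computable U \<and>
     (\<forall>V. partial_computable V \<longrightarrow>
        (\<exists>c::nat. \<forall>x. complexity U x \<le> complexity V x + enat c))"

text \<open>
  A sequence \<open>x\<^sub>1 x\<^sub>2 \<dots>\<close> is a function \<open>X\<close> with \<open>X i\<close> the bit of index \<open>i + 1\<close>, so
  \<open>seq_prefix X n\<close> is \<open>x\<^sub>1 \<dots> x\<^sub>n\<close>.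
\<close>

definition seq_prefix :: "(nat \<Rightarrow> bool) \<Rightarrow> nat \<Rightarrow> bool list" where
  "seq_prefix X n = map X [0..<n]"

definition effective_dim :: "(bool list \<rightharpoonup> bool list) \<Rightarrow> (nat \<Rightarrow> bool) \<Rightarrow> ereal" where
  "effective_dim U X = liminf (\<lambda>n. ereal_of_enat (complexity U (seq_prefix X n)) / ereal (real n))"

text \<open>Only meant for strings of equal length.\<close>

definition hamming :: "bool list \<Rightarrow> bool list \<Rightarrow> nat" where
  "hamming xs ys = card {i. i < length xs \<and> xs ! i \<noteq> ys ! i}"

definition besicovitch_dist :: "(nat \<Rightarrow> bool) \<Rightarrow> (nat \<Rightarrow> bool) \<Rightarrow> ereal" where
  "besicovitch_dist X Y =
     limsup (\<lambda>n. ereal (real (hamming (seq_prefix X n) (seq_prefix Y n)) / real n))"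

end

theory Submission
  imports Defs "HOL-Probability.Probability" "HOL-Real_Asymp.Real_Asymp"
begin

text \<open>
  \<open>X'\<close> is obtained from \<open>X\<close> by flipping each bit independently, the \<open>i\<close>-th one with a probability \<open>\<epsilon> i\<close>
  that tends to \<open>0\<close> very slowly; the flipped positions then almost surely have density \<open>0\<close>.
  Let \<open>A\<close> be the set of strings of length \<open>n\<close> of complexity below \<open>\<sigma> n\<close>, where \<open>\<sigma>\<close> is slightly larger than \<open>\<gamma>\<close>.
  By hypercontractivity, if all flip probabilities \<open>\<epsilon> i\<close> satisfy \<open>\<eta> \<le> \<epsilon> i (1 - \<epsilon> i)\<close>, then the probability \<open>P x\<close>
  that the noise moves \<open>x\<close> into \<open>A\<close> satisfies \<open>(\<Sum>x. (P x)\<^sup>2) \<le> |A| (|A| / 2 ^ n) powr \<eta>\<close>.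
  Hence only \<open>2 ^ (\<tau> n)\<close> strings \<open>x\<close>, for some \<open>\<tau> < \<gamma>\<close>, have \<open>P x \<ge> 1 / (n + 1)\<^sup>2\<close>; they can be enumerated,
  so their complexity is at most about \<open>\<tau> n\<close>, and long prefixes of \<open>X\<close> are not among them.
  By the Borel-Cantelli lemma, almost surely only finitely many prefixes of \<open>X'\<close> lie in \<open>A\<close>.

  The noise levels need not be computable, as \<open>\<delta>\<close> is arbitrary. They are piecewise constant with changes only at a sparse
  set of powers of two, so up to length \<open>n\<close> there are at most \<open>2 n + 1\<close> candidates for them, and the enumeration tries all.
\<close>

subsection \<open>Recursive functions of an environment\<close>

text \<open>An environment \<open>e\<close> gives a value to every variable index, in de Bruijn
  style. The scheme reads only an initial segment, and every sufficiently long segment must do, so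
  functions of different arities combine without arity bookkeeping.\<close>

definition recursive :: "((nat \<Rightarrow> nat) \<Rightarrow> nat) \<Rightarrow> bool" where
  "recursive F \<longleftrightarrow> (\<exists>f m. \<forall>n\<ge>m. \<forall>e. computes f (map e [0..<n]) (F e))"

definition decidable :: "((nat \<Rightarrow> nat) \<Rightarrow> bool) \<Rightarrow> bool" where
  "decidable P \<longleftrightarrow> recursive (\<lambda>e. of_bool (P e))"

named_theorems recursive_intros

lemma recursive_var [recursive_intros]: "recursive (\<lambda>e. e i)"
  unfolding recursive_def
proof (intro exI allI impI)
  fix n :: nat and e :: "nat \<Rightarrow> nat"
  assume "Suc i \<le> n"
  then show "computes (Proj i) (map e [0..<n]) (e i)"
    using computes.Proj[of i "map e [0..<n]"] by simp
qed

text \<open>The scheme for \<open>F\<close> is run on the first \<open>m\<close> variables, so only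
  \<open>G 0\<close> to \<open>G (m - 1)\<close> enter the composition; \<open>sum k {..<m}\<close>
  bounds all their arity thresholds.\<close>

lemma recursive_subst:
  assumes F: "recursive F" and G: "\<And>i. recursive (G i)"
  shows "recursive (\<lambda>e. F (\<lambda>i. G i e))"
proof -
  obtain f m where f: "\<And>n e. n \<ge> m \<Longrightarrow> computes f (map e [0..<n]) (F e)"
    using F unfolding recursive_def by blast
  obtain g k where g: "\<And>i n e. n \<ge> k i \<Longrightarrow> computes (g i) (map e [0..<n]) (G i e)"
    using G unfolding recursive_def by metis
  show ?thesis unfolding recursive_def
  proof (intro exI allI impI)
    fix n :: nat and e :: "nat \<Rightarrow> nat"
    assume n: "sum k {..<m} \<le> n"
    have k: "k i \<le> n" if "i < m" for i
      using member_le_sum[of i "{..<m}" k] that n by simp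
    show "computes (Comp f (map g [0..<m])) (map e [0..<n]) (F (\<lambda>i. G i e))"
      by (rule computes.Comp[where ys = "map (\<lambda>i. G i e) [0..<m]"])
        (auto simp: list_all2_conv_all_nth intro: f g k)
  qed
qed

lemma recursive_const [recursive_intros]: "recursive (\<lambda>e. c)"
proof -
  have "\<exists>f. \<forall>xs. computes f xs c"
  proof (induction c)
    case 0
    show ?case using computes.Zero by blast
  next
    case (Suc c)
    then obtain f where "\<And>xs. computes f xs c" by blast
    then have "computes (Comp Succ [f]) xs (Suc c)" for xs
      by (intro computes.Comp[where ys = "[c]"] computes.Succ) simp
    then show ?case by blast
  qed
  then show ?thesis unfolding recursive_def by blast
qed

lemma recursive_Suc [recursive_intros]:
  assumes "recursive F"
  shows "recursive (\<lambda>e. Suc (F e))"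
proof -
  obtain f m where f: "\<And>n e. n \<ge> m \<Longrightarrow> computes f (map e [0..<n]) (F e)"
    using assms unfolding recursive_def by blast
  have "computes (Comp Succ [f]) (map e [0..<n]) (Suc (F e))" if "n \<ge> m" for n e
    by (rule computes.Comp[where ys = "[F e]"]) (use f that in \<open>auto intro: computes.Succ\<close>)
  then show ?thesis unfolding recursive_def by blast
qed

lemma map_case_nat_upt: "map (case_nat a e) [0..<Suc n] = a # map e [0..<n]"
  by (simp only: upt_conv_Cons[OF zero_less_Suc] map_Suc_upt[symmetric]) simp

text \<open>The step function binds two variables: index 0 is the counter, index 1 the previous
  value, and the outer variables move up by two. The projections in the final \<open>Comp\<close>
  cut the parameter tuple to the fixed length \<open>m\<close>.\<close>

lemma recursive_rec_nat:
  assumes A: "recursive A" and N: "recursive N"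
    and B: "recursive (\<lambda>e. B (e 0) (e 1) (\<lambda>i. e (Suc (Suc i))))"
  shows "recursive (\<lambda>e. rec_nat (A e) (\<lambda>k r. B k r e) (N e))"
proof -
  obtain a ma where a: "\<And>n e. n \<ge> ma \<Longrightarrow> computes a (map e [0..<n]) (A e)"
    using A unfolding recursive_def by blast
  obtain c mc where c: "\<And>n e. n \<ge> mc \<Longrightarrow> computes c (map e [0..<n]) (N e)"
    using N unfolding recursive_def by blast
  obtain b mb where b: "\<And>n e. n \<ge> mb \<Longrightarrow>
      computes b (map e [0..<n]) (B (e 0) (e 1) (\<lambda>i. e (Suc (Suc i))))"
    using B unfolding recursive_def by blast
  define m where "m = max ma mb"
  have b': "computes b (k # r # map e [0..<m]) (B k r e)" for k r e
    using b[of "Suc (Suc m)" "case_nat k (case_nat r e)"] unfolding m_def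
    by (simp only: map_case_nat_upt) simp
  have rec: "computes (PrimRec a b) (k # map e [0..<m]) (rec_nat (A e) (\<lambda>k r. B k r e) k)" for k e
  proof (induction k)
    case 0
    then show ?case using a[of m] by (auto simp: m_def intro: computes.PrimRec_0)
  next
    case (Suc k)
    then show ?case using b' by (auto intro: computes.PrimRec_Suc)
  qed
  have "computes (Comp (PrimRec a b) (c # map Proj [0..<m])) (map e [0..<n])
      (rec_nat (A e) (\<lambda>k r. B k r e) (N e))" if "n \<ge> max m mc" for n e
  proof (rule computes.Comp[OF _ rec])
    show "list_all2 (\<lambda>g. computes g (map e [0..<n])) (c # map Proj [0..<m])
        (N e # map e [0..<m])"
      using that computes.Proj[of _ "map e [0..<n]"]
      by (auto simp: list_all2_conv_all_nth nth_Cons' intro: c)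
  qed
  then show ?thesis unfolding recursive_def by blast
qed

section \<open>Arithmetic, bounded sums and bounded products\<close>

lemma recursive_add [recursive_intros]:
  assumes "recursive F" "recursive G"
  shows "recursive (\<lambda>e. F e + G e)"
proof -
  have "rec_nat a (\<lambda>_. Suc) n = a + n" for a n by (induction n) auto
  then show ?thesis
    using recursive_rec_nat[OF assms, where B = "\<lambda>k r e. Suc r"]
    by (simp add: recursive_Suc recursive_var)
qed

lemma recursive_shift:
  assumes "recursive F"
  shows "recursive (\<lambda>e. F (\<lambda>i. e (i + k)))"
  by (rule recursive_subst[OF assms]) (rule recursive_var)

lemma recursive_mult [recursive_intros]:
  assumes "recursive F" "recursive G"
  shows "recursive (\<lambda>e. F e * G e)"
proof -
  have "rec_nat 0 (\<lambda>k r. r + a) n = a * n" for a n :: nat by (induction n) auto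
  then show ?thesis
    using recursive_rec_nat[OF recursive_const[of 0] assms(2), where B = "\<lambda>k r e. r + F e"]
      recursive_shift[OF assms(1), of 2]
    by (simp add: recursive_add recursive_var)
qed

lemma recursive_power [recursive_intros]:
  assumes "recursive F" "recursive G"
  shows "recursive (\<lambda>e. F e ^ G e)"
proof -
  have "rec_nat 1 (\<lambda>k r. r * a) n = a ^ n" for a n :: nat by (induction n) auto
  then show ?thesis
    using recursive_rec_nat[OF recursive_const[of 1] assms(2), where B = "\<lambda>k r e. r * F e"]
      recursive_shift[OF assms(1), of 2]
    by (simp add: recursive_mult recursive_var)
qed

lemma recursive_diff [recursive_intros]:
  assumes "recursive F" "recursive G"
  shows "recursive (\<lambda>e. F e - G e)"
proof -
  have pred: "recursive (\<lambda>e. H e - 1)" if "recursive H" for H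
  proof -
    have "rec_nat 0 (\<lambda>k r. k) n = n - 1" for n :: nat by (cases n) auto
    then show ?thesis
      using recursive_rec_nat[OF recursive_const[of 0] that, where B = "\<lambda>k r e. k"]
      by (simp add: recursive_var)
  qed
  have "rec_nat a (\<lambda>k r. r - 1) n = a - n" for a n :: nat by (induction n) auto
  then show ?thesis
    using recursive_rec_nat[OF assms, where B = "\<lambda>k r e. r - 1"] pred[OF recursive_var]
    by simp
qed

text \<open>Makes room for an accumulator at index 1: a summand that binds only its counter becomes
  a step function for primitive recursion.\<close>

lemma recursive_skip:
  assumes "recursive F"
  shows "recursive (\<lambda>e. F (\<lambda>i. e (if i = 0 then 0 else Suc i)))"
  by (rule recursive_subst[OF assms]) (rule recursive_var)

lemma recursive_sum [recursive_intros]: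
  assumes "recursive N" and "recursive (\<lambda>e. H (e 0) (\<lambda>i. e (Suc i)))"
  shows "recursive (\<lambda>e. \<Sum>i<N e. H i e)"
proof -
  have "recursive (\<lambda>e. H (e 0) (\<lambda>i. e (Suc (Suc i))))"
    using recursive_skip[OF assms(2)] by simp
  then have "recursive (\<lambda>e. rec_nat 0 (\<lambda>k r. r + H k e) (N e))"
    by (intro recursive_rec_nat recursive_intros assms)
  moreover have "rec_nat 0 (\<lambda>k r. r + H k e) n = (\<Sum>i<n. H i e)" for n e
    by (induction n) auto
  ultimately show ?thesis by simp
qed

lemma recursive_prod [recursive_intros]:
  assumes "recursive N" and "recursive (\<lambda>e. H (e 0) (\<lambda>i. e (Suc i)))"
  shows "recursive (\<lambda>e. \<Prod>i<N e. H i e)"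
proof -
  have "recursive (\<lambda>e. H (e 0) (\<lambda>i. e (Suc (Suc i))))"
    using recursive_skip[OF assms(2)] by simp
  then have "recursive (\<lambda>e. rec_nat 1 (\<lambda>k r. r * H k e) (N e))"
    by (intro recursive_rec_nat recursive_intros assms)
  moreover have "rec_nat 1 (\<lambda>k r. r * H k e) n = (\<Prod>i<n. H i e)" for n e
    by (induction n) auto
  ultimately show ?thesis by simp
qed

section \<open>Decidable predicates and definition by cases\<close>

lemma recursive_of_bool [recursive_intros]:
  "decidable P \<Longrightarrow> recursive (\<lambda>e. of_bool (P e))"
  by (simp add: decidable_def)

lemma decidable_not [recursive_intros]:
  assumes "decidable P"
  shows "decidable (\<lambda>e. \<not> P e)"
proof -
  have "recursive (\<lambda>e. 1 - of_bool (P e))"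
    by (intro recursive_intros assms)
  moreover have "(1 - of_bool b :: nat) = of_bool (\<not> b)" for b by simp
  ultimately show ?thesis unfolding decidable_def by simp
qed

lemma decidable_conj [recursive_intros]:
  assumes "decidable P" "decidable Q"
  shows "decidable (\<lambda>e. P e \<and> Q e)"
proof -
  have "recursive (\<lambda>e. of_bool (P e) * of_bool (Q e))"
    by (intro recursive_intros assms)
  then show ?thesis unfolding decidable_def by (simp add: of_bool_conj)
qed

lemma decidable_le [recursive_intros]:
  assumes "recursive F" "recursive G"
  shows "decidable (\<lambda>e. F e \<le> G e)"
proof -
  have "recursive (\<lambda>e. 1 - (F e - G e))"
    by (intro recursive_intros assms)
  moreover have "1 - (a - b) = (of_bool (a \<le> b) :: nat)" for a b :: nat by auto
  ultimately show ?thesis unfolding decidable_def by simp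
qed

lemma decidable_less [recursive_intros]:
  assumes "recursive F" "recursive G"
  shows "decidable (\<lambda>e. F e < G e)"
  using decidable_not[OF decidable_le[OF assms(2,1)]] by (simp add: not_le)

lemma decidable_eq [recursive_intros]:
  assumes "recursive F" "recursive G"
  shows "decidable (\<lambda>e. F e = G e)"
  unfolding order_eq_iff by (intro recursive_intros assms)

lemma decidable_bool_eq [recursive_intros]:
  assumes "decidable P" "decidable Q"
  shows "decidable (\<lambda>e. P e = Q e)"
proof -
  have "decidable (\<lambda>e. (of_bool (P e) :: nat) = of_bool (Q e))"
    by (intro recursive_intros assms)
  moreover have "(of_bool b = (of_bool c :: nat)) = (b = c)" for b c by auto
  ultimately show ?thesis by simp
qed

lemma recursive_If [recursive_intros]:
  assumes "decidable P" "recursive F" "recursive G"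
  shows "recursive (\<lambda>e. if P e then F e else G e)"
proof -
  have "recursive (\<lambda>e. of_bool (P e) * F e + of_bool (\<not> P e) * G e)"
    by (intro recursive_intros assms)
  moreover have "of_bool b * (x::nat) + of_bool (\<not> b) * y = (if b then x else y)" for b x y
    by simp
  ultimately show ?thesis by simp
qed

lemma recursive_min [recursive_intros]:
  assumes "recursive F" "recursive G"
  shows "recursive (\<lambda>e. min (F e) (G e))"
  unfolding min_def by (intro recursive_intros assms)

lemma decidable_Ex [recursive_intros]:
  assumes "recursive N" "decidable (\<lambda>e. P (e 0) (\<lambda>i. e (Suc i)))"
  shows "decidable (\<lambda>e. \<exists>i<N e. P i e)"
proof -
  have "decidable (\<lambda>e. 0 < (\<Sum>i<N e. of_bool (P i e) :: nat))"
    by (intro recursive_intros assms)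
  moreover have "0 < (\<Sum>i<n. of_bool (Q i) :: nat) \<longleftrightarrow> (\<exists>i<n. Q i)" for n and Q :: "nat \<Rightarrow> bool"
    by (auto simp: zero_less_iff_neq_zero)
  ultimately show ?thesis by simp
qed

lemma decidable_All [recursive_intros]:
  assumes "recursive N" "decidable (\<lambda>e. P (e 0) (\<lambda>i. e (Suc i)))"
  shows "decidable (\<lambda>e. \<forall>i<N e. P i e)"
proof -
  have "decidable (\<lambda>e. \<not> (\<exists>i<N e. \<not> P i e))"
    by (intro recursive_intros assms)
  then show ?thesis by simp
qed

text \<open>The quotient counts the positive multiples of \<open>b\<close> up to \<open>a\<close>;
  the conjunct \<open>0 < b\<close> produces the convention \<open>a div 0 = 0\<close>.\<close>

lemma div_eq_sum_of_bool:
  "a div b = (\<Sum>i<a. of_bool (0 < b \<and> Suc i * b \<le> a) :: nat)" for a b :: nat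
proof (cases "b = 0")
  case False
  then have "Suc i * b \<le> a \<longleftrightarrow> i < a div b" for i
    by (metis Suc_le_eq less_eq_div_iff_mult_less_eq bot_nat_0.not_eq_extremum)
  with False have "(\<Sum>i<a. of_bool (0 < b \<and> Suc i * b \<le> a) :: nat) = card {i. i < a \<and> i < a div b}"
    by (simp add: sum_of_bool_eq Int_def)
  also have "{i. i < a \<and> i < a div b} = {..<a div b}"
    using div_le_dividend[of a b] by (auto intro: less_le_trans)
  finally show ?thesis by simp
qed simp

lemma recursive_div [recursive_intros]:
  assumes "recursive F" "recursive G"
  shows "recursive (\<lambda>e. F e div G e)"
  using recursive_shift[OF assms(1), of 1] recursive_shift[OF assms(2), of 1]
  unfolding div_eq_sum_of_bool by (intro recursive_intros assms) auto

lemma recursive_mod [recursive_intros]: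
  assumes "recursive F" "recursive G"
  shows "recursive (\<lambda>e. F e mod G e)"
  unfolding modulo_nat_def by (intro recursive_intros assms)

lemma decidable_odd [recursive_intros]:
  assumes "recursive F"
  shows "decidable (\<lambda>e. odd (F e))"
  unfolding odd_iff_mod_2_eq_one by (intro recursive_intros assms)

text \<open>Here \<open>k\<close> is a fixed number and the \<open>P i\<close> are separate
  predicates without a common scheme, so the conjunction is built by induction on \<open>k\<close>
  and not by bounded search.\<close>

lemma decidable_finite_All:
  fixes k :: nat
  assumes "\<And>i. i < k \<Longrightarrow> decidable (P i)"
  shows "decidable (\<lambda>e. \<forall>i<k. P i e)"
  using assms
proof (induction k)
  case 0
  have "decidable (\<lambda>e. (0::nat) = 0)" by (intro recursive_intros)
  then show ?case by simp
next
  case (Suc k)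
  then have "decidable (\<lambda>e. P k e \<and> (\<forall>i<k. P i e))" by (intro decidable_conj) auto
  then show ?case by (simp add: All_less_Suc)
qed

subsection \<open>Stagewise evaluation\<close>

text \<open>\<open>E t xs\<close> is \<open>Suc y\<close> once the computation has been seen to halt with value \<open>y\<close>, and \<open>0\<close> before.\<close>

definition stagewise :: "recf \<Rightarrow> nat \<Rightarrow> (nat \<Rightarrow> nat list \<Rightarrow> nat) \<Rightarrow> bool" where
  "stagewise f n E \<longleftrightarrow>
     (\<forall>xs y. length xs = n \<longrightarrow> (computes f xs y \<longleftrightarrow> (\<exists>t. E t xs = Suc y))) \<and>
     (\<forall>t t' xs y. t \<le> t' \<longrightarrow> E t xs = Suc y \<longrightarrow> E t' xs = Suc y) \<and>
     recursive (\<lambda>e. E (e 0) (map (\<lambda>i. e (Suc i)) [0..<n]))"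

lemma stagewiseI:
  assumes "\<And>xs y t. length xs = n \<Longrightarrow> E t xs = Suc y \<Longrightarrow> computes f xs y"
    and "\<And>xs y. length xs = n \<Longrightarrow> computes f xs y \<Longrightarrow> \<exists>t. E t xs = Suc y"
    and "\<And>t t' xs y. t \<le> t' \<Longrightarrow> E t xs = Suc y \<Longrightarrow> E t' xs = Suc y"
    and "recursive (\<lambda>e. E (e 0) (map (\<lambda>i. e (Suc i)) [0..<n]))"
  shows "stagewise f n E"
  using assms unfolding stagewise_def by blast

lemma stagewise_sound: "stagewise f n E \<Longrightarrow> length xs = n \<Longrightarrow> E t xs = Suc y \<Longrightarrow> computes f xs y"
  and stagewise_complete: "stagewise f n E \<Longrightarrow> length xs = n \<Longrightarrow> computes f xs y \<Longrightarrow> \<exists>t. E t xs = Suc y"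
  and stagewise_mono: "stagewise f n E \<Longrightarrow> E t xs = Suc y \<Longrightarrow> t \<le> t' \<Longrightarrow> E t' xs = Suc y"
  and stagewise_recursive: "stagewise f n E \<Longrightarrow> recursive (\<lambda>e. E (e 0) (map (\<lambda>i. e (Suc i)) [0..<n]))"
  unfolding stagewise_def by blast+

lemma recursive_stagewise_subst:
  assumes E: "stagewise f n E" and T: "recursive T" and G: "\<And>i. i < n \<Longrightarrow> recursive (G i)"
  shows "recursive (\<lambda>e. E (T e) (map (\<lambda>i. G i e) [0..<n]))"
proof -
  \<comment> \<open>Index 0 holds the stage and index \<open>Suc j\<close> the argument
    \<open>j\<close>. The constant 0 fills the indices beyond the arity, because
    \<open>recursive_subst\<close> replaces every variable.\<close>
  define G' where "G' i = (case i of 0 \<Rightarrow> T | Suc j \<Rightarrow> if j < n then G j else (\<lambda>e. 0))" for i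
  have "recursive (G' i)" for i
    using T G by (auto simp: G'_def recursive_const split: nat.split)
  from recursive_subst[OF stagewise_recursive[OF E] this]
  have "recursive (\<lambda>e. E (G' 0 e) (map (\<lambda>i. G' (Suc i) e) [0..<n]))" .
  moreover have "map (\<lambda>i. G' (Suc i) e) [0..<n] = map (\<lambda>i. G i e) [0..<n]" for e
    by (simp add: G'_def)
  moreover have "G' 0 e = T e" for e
    by (simp add: G'_def)
  ultimately show ?thesis by simp
qed

lemma recursive_stagewise_Cons:
  assumes E: "stagewise f (Suc n) E" and T: "recursive T" and A: "recursive A"
    and G: "\<And>i. i < n \<Longrightarrow> recursive (G i)"
  shows "recursive (\<lambda>e. E (T e) (A e # map (\<lambda>i. G i e) [0..<n]))"
proof -
  have "recursive (\<lambda>e. E (T e) (map (\<lambda>i. (case i of 0 \<Rightarrow> A | Suc j \<Rightarrow> G j) e) [0..<Suc n]))"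
    using A G by (intro recursive_stagewise_subst[OF E T]) (auto split: nat.split)
  moreover have "map (\<lambda>i. (case i of 0 \<Rightarrow> A | Suc j \<Rightarrow> G j) e) [0..<Suc n]
      = A e # map (\<lambda>i. G i e) [0..<n]" for e
    by (simp only: upt_conv_Cons[OF zero_less_Suc] map_Suc_upt[symmetric]) simp
  ultimately show ?thesis by simp
qed

lemma stagewise_Zero: "stagewise Zero n (\<lambda>t xs. 1)"
  by (rule stagewiseI) (auto intro: computes.Zero recursive_intros elim: computesE)

lemma stagewise_Succ: "\<exists>E. stagewise Succ n E"
proof (cases "n = 1")
  case True
  have "stagewise Succ n (\<lambda>t xs. Suc (Suc (xs ! 0)))"
  proof (rule stagewiseI)
    show "recursive (\<lambda>e. Suc (Suc (map (\<lambda>i. e (Suc i)) [0..<n] ! 0)))"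
      using True by (simp, intro recursive_intros)
  qed (use True in \<open>auto simp: length_Suc_conv intro: computes.Succ elim: computesE\<close>)
  then show ?thesis by blast
next
  case False
  then have "stagewise Succ n (\<lambda>t xs. 0)"
    by (intro stagewiseI) (auto intro: recursive_intros elim: computesE)
  then show ?thesis by blast
qed

lemma stagewise_Proj: "\<exists>E. stagewise (Proj i) n E"
proof (cases "i < n")
  case True
  have "stagewise (Proj i) n (\<lambda>t xs. Suc (xs ! i))"
  proof (rule stagewiseI)
    show "recursive (\<lambda>e. Suc (map (\<lambda>i. e (Suc i)) [0..<n] ! i))"
      using True by (simp, intro recursive_intros)
  qed (use True in \<open>auto intro: computes.Proj elim: computesE\<close>)
  then show ?thesis by blast
next
  case False
  then have "stagewise (Proj i) n (\<lambda>t xs. 0)"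
    by (intro stagewiseI) (auto intro: recursive_intros elim: computesE)
  then show ?thesis by blast
qed

lemma stagewise_Comp:
  assumes f: "\<And>n. \<exists>E. stagewise f n E" and gs: "\<And>g n. g \<in> set gs \<Longrightarrow> \<exists>E. stagewise g n E"
  shows "\<exists>E. stagewise (Comp f gs) n E"
proof -
  define k where "k = length gs"
  obtain F where F: "stagewise f k F" using f by blast
  have "\<forall>i. \<exists>E. i < k \<longrightarrow> stagewise (gs ! i) n E"
    using gs unfolding k_def by (meson nth_mem)
  then obtain G where G: "\<And>i. i < k \<Longrightarrow> stagewise (gs ! i) n (G i)" by metis
  \<comment> \<open>Stage \<open>t\<close> answers only when all inner computations have answered;
    \<open>- 1\<close> strips the \<open>Suc\<close> that marks an answer.\<close>
  define E where "E t xs = (if \<forall>i<k. 0 < G i t xs then F t (map (\<lambda>i. G i t xs - 1) [0..<k]) else 0)" for t xs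
  have "stagewise (Comp f gs) n E"
  proof (rule stagewiseI)
    fix xs :: "nat list" and y t assume xs: "length xs = n" and "E t xs = Suc y"
    then have pos: "\<And>i. i < k \<Longrightarrow> 0 < G i t xs" and y: "F t (map (\<lambda>i. G i t xs - 1) [0..<k]) = Suc y"
      by (auto simp: E_def split: if_splits)
    show "computes (Comp f gs) xs y"
    proof (rule computes.Comp[where ys = "map (\<lambda>i. G i t xs - 1) [0..<k]"])
      show "list_all2 (\<lambda>g. computes g xs) gs (map (\<lambda>i. G i t xs - 1) [0..<k])"
        using stagewise_sound[OF G xs] pos by (auto simp: list_all2_conv_all_nth k_def)
      show "computes f (map (\<lambda>i. G i t xs - 1) [0..<k]) y"
        using stagewise_sound[OF F _ y] by simp
    qed
  next
    fix xs :: "nat list" and y assume xs: "length xs = n" and "computes (Comp f gs) xs y"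
    then obtain ys where ys: "list_all2 (\<lambda>g. computes g xs) gs ys" and y: "computes f ys y"
      by (auto elim: computesE)
    then have len: "length ys = k" by (simp add: list_all2_lengthD k_def)
    have "\<forall>i. \<exists>t. i < k \<longrightarrow> G i t xs = Suc (ys ! i)"
      using stagewise_complete[OF G xs] ys by (auto simp: list_all2_conv_all_nth k_def)
    then obtain t where t: "\<And>i. i < k \<Longrightarrow> G i (t i) xs = Suc (ys ! i)" by metis
    obtain t0 where t0: "F t0 ys = Suc y" using stagewise_complete[OF F len y] by blast
    \<comment> \<open>One stage late enough for all arguments and for the outer scheme; monotonicity
      carries every answer there.\<close>
    define t' where "t' = t0 + sum t {..<k}"
    have *: "G i t' xs = Suc (ys ! i)" if "i < k" for i
      using member_le_sum[of i "{..<k}" t] that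
      by (intro stagewise_mono[OF G t]) (auto simp: t'_def)
    then have "map (\<lambda>i. G i t' xs - 1) [0..<k] = ys"
      using len by (intro nth_equalityI) auto
    then have "E t' xs = F t' ys" using * by (simp add: E_def)
    also have "\<dots> = Suc y" by (rule stagewise_mono[OF F t0]) (simp add: t'_def)
    finally show "\<exists>t. E t xs = Suc y" by blast
  next
    fix t t' xs y assume le: "t \<le> t'" and "E t xs = Suc y"
    then have pos: "\<And>i. i < k \<Longrightarrow> 0 < G i t xs" and y: "F t (map (\<lambda>i. G i t xs - 1) [0..<k]) = Suc y"
      by (auto simp: E_def split: if_splits)
    have eq: "G i t' xs = G i t xs" if "i < k" for i
      using stagewise_mono[OF G[OF that] _ le, of xs "G i t xs - 1"] pos[OF that] by simp
    then have map_eq: "map (\<lambda>i. G i t' xs - 1) [0..<k] = map (\<lambda>i. G i t xs - 1) [0..<k]" by simp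
    have "\<forall>i<k. 0 < G i t' xs" using pos eq by simp
    then have "E t' xs = F t' (map (\<lambda>i. G i t xs - 1) [0..<k])"
      unfolding E_def map_eq by (rule if_P)
    then show "E t' xs = Suc y" using stagewise_mono[OF F y le] by simp
  next
    show "recursive (\<lambda>e. E (e 0) (map (\<lambda>i. e (Suc i)) [0..<n]))"
      unfolding E_def
      by (intro recursive_If decidable_finite_All decidable_less recursive_const
          recursive_stagewise_subst[OF F] recursive_diff recursive_var stagewise_recursive[OF G])
  qed
  then show ?thesis by blast
qed

lemma stagewise_PrimRec:
  assumes f: "\<And>n. \<exists>E. stagewise f n E" and g: "\<And>n. \<exists>E. stagewise g n E"
  shows "\<exists>E. stagewise (PrimRec f g) n E"
proof (cases n)
  case 0
  \<comment> \<open>\<open>PrimRec\<close> is undefined on the empty tuple, so the evaluator never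
    answers.\<close>
  then have "stagewise (PrimRec f g) n (\<lambda>t xs. 0)"
    by (intro stagewiseI) (auto intro: recursive_intros elim: computes.cases)
  then show ?thesis by blast
next
  case (Suc m)
  obtain F where F: "stagewise f m F" using f by blast
  obtain G where G: "stagewise g (Suc (Suc m)) G" using g by blast
  \<comment> \<open>A missing answer, coded 0, propagates through the recursion; a present one loses
    its \<open>Suc\<close> before it is passed to \<open>g\<close>.\<close>
  define R where "R t xs k = rec_nat (F t xs) (\<lambda>k r. if r = 0 then 0 else G t (k # (r - 1) # xs)) k" for t xs k
  define E where "E t xs = R t (tl xs) (hd xs)" for t xs
  have R_simps: "R t xs 0 = F t xs"
    "R t xs (Suc k) = (if R t xs k = 0 then 0 else G t (k # (R t xs k - 1) # xs))" for t xs k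
    by (simp_all add: R_def)
  have sound: "computes (PrimRec f g) (k # xs) y" if "length xs = m" "R t xs k = Suc y" for t xs k y
    using that(2)
  proof (induction k arbitrary: y)
    case 0
    then show ?case using stagewise_sound[OF F that(1)] by (auto simp: R_simps intro: computes.PrimRec_0)
  next
    case (Suc k)
    then have *: "R t xs k = Suc (R t xs k - 1)" "G t (k # (R t xs k - 1) # xs) = Suc y"
      by (auto simp: R_simps split: if_splits)
    show ?case
      by (rule computes.PrimRec_Suc[OF Suc.IH[OF *(1)] stagewise_sound[OF G _ *(2)]]) (simp add: that(1))
  qed
  have mono: "R t' xs k = Suc y" if "R t xs k = Suc y" "t \<le> t'" for t t' xs k y
    using that(1)
  proof (induction k arbitrary: y)
    case 0
    then show ?case using stagewise_mono[OF F _ that(2)] by (simp add: R_simps)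
  next
    case (Suc k)
    then have *: "R t xs k = Suc (R t xs k - 1)" "G t (k # (R t xs k - 1) # xs) = Suc y"
      by (auto simp: R_simps split: if_splits)
    show ?case
      using Suc.IH[OF *(1)] stagewise_mono[OF G *(2) that(2)] by (simp add: R_simps)
  qed
  have complete: "\<exists>t. R t xs k = Suc y" if len: "length xs = m" and "computes (PrimRec f g) (k # xs) y" for xs k y
    using that(2)
  proof (induction k arbitrary: y)
    case 0
    then show ?case using stagewise_complete[OF F that(1)] by (auto simp: R_simps elim: computesE)
  next
    case (Suc k)
    then obtain r where r: "computes (PrimRec f g) (k # xs) r" "computes g (k # r # xs) y"
      by (auto elim: computesE)
    obtain t where t: "R t xs k = Suc r" using Suc.IH[OF r(1)] by blast
    obtain t' where t': "G t' (k # r # xs) = Suc y"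
      using stagewise_complete[OF G _ r(2)] len by auto
    have "R (max t t') xs k = Suc r" by (rule mono[OF t]) simp
    moreover have "G (max t t') (k # r # xs) = Suc y" by (rule stagewise_mono[OF G t']) simp
    ultimately have "R (max t t') xs (Suc k) = Suc y" by (simp add: R_simps)
    then show ?case by blast
  qed
  have "stagewise (PrimRec f g) n E"
  proof (rule stagewiseI)
    show "recursive (\<lambda>e. E (e 0) (map (\<lambda>i. e (Suc i)) [0..<n]))"
    proof -
      have "recursive (\<lambda>e. rec_nat (F (e 0) (map (\<lambda>i. e (Suc (Suc i))) [0..<m]))
          (\<lambda>k r. if r = 0 then 0 else G (e 0) (k # (r - 1) # map (\<lambda>i. e (Suc (Suc i))) [0..<m])) (e 1))"
      proof (rule recursive_rec_nat)
        show "recursive (\<lambda>e. F (e 0) (map (\<lambda>i. e (Suc (Suc i))) [0..<m]))"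
          by (intro recursive_stagewise_subst[OF F] recursive_var)
        have "recursive (\<lambda>e. G (e (Suc (Suc 0))) (e 0 # map (\<lambda>i. (case i of 0 \<Rightarrow> \<lambda>e. e 1 - 1
            | Suc j \<Rightarrow> \<lambda>e. e (Suc (Suc (Suc (Suc j))))) e) [0..<Suc m]))"
          by (intro recursive_stagewise_Cons[OF G] recursive_var)
            (auto intro!: recursive_intros split: nat.split)
        moreover have "map (\<lambda>i. (case i of 0 \<Rightarrow> \<lambda>e. e 1 - 1
            | Suc j \<Rightarrow> \<lambda>e. e (Suc (Suc (Suc (Suc j))))) e) [0..<Suc m]
            = (e 1 - 1) # map (\<lambda>i. e (Suc (Suc (Suc (Suc i))))) [0..<m]" for e :: "nat \<Rightarrow> nat"
          by (simp only: upt_conv_Cons[OF zero_less_Suc] map_Suc_upt[symmetric]) simp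
        ultimately have "recursive (\<lambda>e. G (e (Suc (Suc 0)))
            (e 0 # (e 1 - 1) # map (\<lambda>i. e (Suc (Suc (Suc (Suc i))))) [0..<m]))"
          by simp
        then show "recursive (\<lambda>e. if e 1 = 0 then 0 else
            G (e (Suc (Suc 0))) (e 0 # (e 1 - 1) # map (\<lambda>i. e (Suc (Suc (Suc (Suc i))))) [0..<m]))"
          by (intro recursive_If decidable_eq recursive_var recursive_const)
      qed (rule recursive_var)
      moreover have "map (\<lambda>i. e (Suc i)) [0..<Suc m] = e 1 # map (\<lambda>i. e (Suc (Suc i))) [0..<m]"
        for e :: "nat \<Rightarrow> nat"
        by (simp only: upt_conv_Cons[OF zero_less_Suc] map_Suc_upt[symmetric]) simp
      ultimately show ?thesis by (simp add: E_def R_def Suc del: upt_Suc)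
    qed
  next
    fix xs :: "nat list" and y t assume "length xs = n" "E t xs = Suc y"
    then show "computes (PrimRec f g) xs y"
      using sound by (cases xs) (auto simp: E_def Suc)
  next
    fix xs :: "nat list" and y assume "length xs = n" "computes (PrimRec f g) xs y"
    then show "\<exists>t. E t xs = Suc y"
      using complete by (cases xs) (auto simp: E_def Suc)
  qed (auto simp: E_def intro: mono)
  then show ?thesis by blast
qed

lemma stagewise_Mu:
  assumes f: "\<And>n. \<exists>E. stagewise f n E"
  shows "\<exists>E. stagewise (Mu f) n E"
proof -
  obtain F where F: "stagewise f (Suc n) F" using f by blast
  \<comment> \<open>Because of the marking \<open>Suc\<close>, the value 1 is an observed zero of
    \<open>f\<close> and a larger value an observed nonzero result.\<close>
  define found where "found t xs k \<longleftrightarrow> F t (k # xs) = 1 \<and> (\<forall>m<k. 1 < F t (m # xs))" for t xs k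
  \<comment> \<open>Restricting the candidates to \<open>k < t\<close> makes the search recursive.
    At most one candidate qualifies, so the sum has at most one nonzero term.\<close>
  define E where "E t xs = (\<Sum>k<t. if found t xs k then Suc k else 0)" for t xs
  have unique: "k = k'" if "found t xs k" "found t xs k'" for t xs k k'
  proof (rule ccontr)
    assume "k \<noteq> k'"
    then consider "k < k'" | "k' < k" by linarith
    then show False using that unfolding found_def by cases (metis less_irrefl)+
  qed
  have E_eq: "E t xs = Suc k" if "found t xs k" "k < t" for t xs k
  proof -
    have "found t xs k' \<longleftrightarrow> k' = k" for k'
      using unique[of t xs k' k] that(1) by blast
    then have "E t xs = (\<Sum>k'<t. if k' = k then Suc k else 0)"
      unfolding E_def by (intro sum.cong) auto
    then show ?thesis using that(2) by simp
  qed
  have E_found: "\<exists>k<t. found t xs k" if "E t xs \<noteq> 0" for t xs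
    using that by (auto simp: E_def split: if_splits)
  have E_D: "found t xs k \<and> k < t" if "E t xs = Suc k" for t xs k
  proof -
    have "\<exists>k'<t. found t xs k'" using E_found[of t xs] that by simp
    then obtain k' where "found t xs k'" "k' < t" by blast
    with E_eq[of t xs k'] that show ?thesis by simp
  qed
  have found_mono: "found t' xs k" if "found t xs k" "t \<le> t'" for t t' xs k
  proof -
    have "F t' (k # xs) = Suc 0"
      using stagewise_mono[OF F _ that(2)] that(1) by (simp add: found_def)
    moreover have "1 < F t' (m # xs)" if "m < k" for m
    proof -
      have m: "1 < F t (m # xs)" using \<open>found t xs k\<close> that by (simp add: found_def)
      then have "F t (m # xs) = Suc (F t (m # xs) - 1)" by simp
      from stagewise_mono[OF F this \<open>t \<le> t'\<close>] m show ?thesis by simp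
    qed
    ultimately show ?thesis by (simp add: found_def)
  qed
  have "stagewise (Mu f) n E"
  proof (rule stagewiseI)
    fix xs :: "nat list" and k t assume xs: "length xs = n" and "E t xs = Suc k"
    then have found: "found t xs k" using E_D by blast
    show "computes (Mu f) xs k"
    proof (rule computes.Mu)
      show "computes f (k # xs) 0"
        using stagewise_sound[OF F, of "k # xs" t 0] xs found by (simp add: found_def)
      show "\<forall>m<k. \<exists>y>0. computes f (m # xs) y"
      proof (intro allI impI)
        fix m assume "m < k"
        then have "1 < F t (m # xs)" using found by (simp add: found_def)
        then show "\<exists>y>0. computes f (m # xs) y"
          using stagewise_sound[OF F, of "m # xs" t "F t (m # xs) - 1"] xs
          by (intro exI[of _ "F t (m # xs) - 1"]) auto
      qed
    qed
  next
    fix xs :: "nat list" and k assume xs: "length xs = n" and "computes (Mu f) xs k"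
    then have c: "computes f (k # xs) 0" "\<forall>m<k. \<exists>y>0. computes f (m # xs) y"
      by (auto elim: computesE(7))
    obtain t0 where t0: "F t0 (k # xs) = Suc 0"
      using stagewise_complete[OF F _ c(1)] xs by auto
    have "\<forall>m. \<exists>t. m < k \<longrightarrow> (\<exists>y>0. F t (m # xs) = Suc y)"
    proof
      fix m
      show "\<exists>t. m < k \<longrightarrow> (\<exists>y>0. F t (m # xs) = Suc y)"
      proof (cases "m < k")
        case True
        then obtain y where "y > 0" "computes f (m # xs) y" using c(2) by blast
        then show ?thesis using stagewise_complete[OF F, of "m # xs" y] xs by auto
      qed simp
    qed
    then obtain t where t: "\<And>m. m < k \<Longrightarrow> \<exists>y>0. F (t m) (m # xs) = Suc y" by metis
    \<comment> \<open>The summand \<open>Suc k\<close> puts the candidate \<open>k\<close> inside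
      the search range of stage \<open>t'\<close>.\<close>
    define t' where "t' = Suc k + t0 + sum t {..<k}"
    have "F t' (k # xs) = Suc 0"
      by (rule stagewise_mono[OF F t0]) (simp add: t'_def)
    moreover have "1 < F t' (m # xs)" if m: "m < k" for m
    proof -
      obtain y where y: "y > 0" "F (t m) (m # xs) = Suc y" using t[OF m] by blast
      have "t m \<le> t'" using member_le_sum[of m "{..<k}" t] m by (simp add: t'_def)
      with y show ?thesis using stagewise_mono[OF F y(2)] by simp
    qed
    ultimately have "found t' xs k" by (simp add: found_def)
    then have "E t' xs = Suc k" by (rule E_eq) (simp add: t'_def)
    then show "\<exists>t. E t xs = Suc k" by blast
  next
    fix t t' xs k assume "t \<le> t'" "E t xs = Suc k"
    with E_D[of t xs k] have "found t xs k" "k < t'" by auto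
    then show "E t' xs = Suc k" using \<open>t \<le> t'\<close> by (intro E_eq found_mono[of t xs k t'])
  next
    have *: "recursive (\<lambda>e. F (e j) (e i # map (\<lambda>i. e (i + l)) [0..<n]))" for i j l
      by (intro recursive_stagewise_Cons[OF F] recursive_var)
    show "recursive (\<lambda>e. E (e 0) (map (\<lambda>i. e (Suc i)) [0..<n]))"
      unfolding E_def found_def
      by (rule recursive_sum[OF recursive_var], rule recursive_If, rule decidable_conj,
          rule decidable_eq, use *[of 1 0 2] in \<open>simp add: numeral_eq_Suc\<close>,
          rule recursive_const, rule decidable_All[OF recursive_var], rule decidable_less,
          rule recursive_const, use *[of 2 0 3] in \<open>simp add: numeral_eq_Suc\<close>)
        (intro recursive_intros)+
  qed
  then show ?thesis by blast
qed

text \<open>Structural induction for all arities at once, since subschemes are called at other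
  arities. Applied to a scheme for \<open>U\<close>, it yields recursive approximations to the set
  of halting programs.\<close>

theorem stagewise_exists: "\<exists>E. stagewise f n E"
proof (induction f arbitrary: n)
  case Zero
  show ?case using stagewise_Zero by blast
next
  case (Comp f gs)
  then show ?case by (intro stagewise_Comp) auto
qed (auto intro: stagewise_Succ stagewise_Proj stagewise_PrimRec stagewise_Mu)

subsection \<open>Complexity of the elements of a small enumerable family\<close>

text \<open>Variables beyond the given arguments are supplied by \<open>Zero\<close>, so a scheme
  for long environments also serves tuples of length \<open>n\<close>.\<close>

lemma recursive_fixed_arity:
  assumes "recursive F"
  shows "\<exists>f. \<forall>xs. length xs = n \<longrightarrow> computes f xs (F (\<lambda>i. if i < n then xs ! i else 0))"
proof -
  obtain f m where f: "\<And>k e. k \<ge> m \<Longrightarrow> computes f (map e [0..<k]) (F e)"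
    using assms unfolding recursive_def by blast
  have "computes (Comp f (map (\<lambda>i. if i < n then Proj i else Zero) [0..<m])) xs
      (F (\<lambda>i. if i < n then xs ! i else 0))" if "length xs = n" for xs
    by (rule computes.Comp[where ys = "map (\<lambda>i. if i < n then xs ! i else 0) [0..<m]"])
      (use that in \<open>auto simp: list_all2_conv_all_nth intro: f computes.Proj computes.Zero\<close>)
  then show ?thesis by blast
qed

lemma inv_str_code [simp]: "inv str_code (str_code x) = x"
  and str_code_inv [simp]: "str_code (inv str_code n) = n"
  using bij_str_code by (simp_all add: bij_is_inj bij_is_surj surj_f_inv_f)

lemma str_code_eq_iff [simp]: "str_code x = str_code y \<longleftrightarrow> x = y"
  using bij_str_code by (simp add: bij_is_inj inj_eq)

text \<open>The machine \<open>Comp g [Mu f, Proj 0]\<close> searches for the least witness and then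
  computes the output from witness and input.\<close>

lemma partial_computable_search:
  assumes P: "decidable (\<lambda>e. P (e 0) (e 1))" and out: "recursive (\<lambda>e. out (e 0) (e 1))"
  shows "partial_computable (\<lambda>p. if \<exists>w. P w (str_code p)
    then Some (inv str_code (out (LEAST w. P w (str_code p)) (str_code p))) else None)"
proof -
  have binary: "\<exists>f. \<forall>w c. computes f [w, c] (F w c)" if F: "recursive (\<lambda>e. F (e 0) (e 1))" for F
  proof -
    obtain f where f: "\<forall>xs. length xs = 2 \<longrightarrow>
        computes f xs (F (if 0 < (2::nat) then xs ! 0 else 0) (if 1 < (2::nat) then xs ! 1 else 0))"
      using recursive_fixed_arity[OF F, of 2] by blast
    have "computes f [w, c] (F w c)" for w c
      using f[rule_format, of "[w, c]"] by simp
    then show ?thesis by blast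
  qed
  \<comment> \<open>\<open>Mu\<close> looks for a zero, hence the negated characteristic
    function.\<close>
  have "recursive (\<lambda>e. of_bool (\<not> P (e 0) (e 1)))" by (intro recursive_intros P)
  from binary[of "\<lambda>w c. of_bool (\<not> P w c)", OF this]
  obtain f where f: "\<And>w c. computes f [w, c] (of_bool (\<not> P w c))" by blast
  obtain g where g: "\<And>w c. computes g [w, c] (out w c)" using binary[of out, OF out] by blast
  have Mu: "computes (Mu f) [c] w \<longleftrightarrow> P w c \<and> (\<forall>v<w. \<not> P v c)" for w c
  proof
    assume "computes (Mu f) [c] w"
    then have *: "computes f [w, c] 0" "\<forall>v<w. \<exists>y>0. computes f [v, c] y"
      by (auto elim: computesE(7))
    have "P w c" using computes_deterministic[OF f *(1)] by (auto split: if_splits)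
    moreover have "\<not> P v c" if "v < w" for v
    proof
      assume "P v c"
      then have "computes f [v, c] 0" using f[of v c] by simp
      with *(2) that computes_deterministic show False by blast
    qed
    ultimately show "P w c \<and> (\<forall>v<w. \<not> P v c)" by blast
  next
    assume *: "P w c \<and> (\<forall>v<w. \<not> P v c)"
    show "computes (Mu f) [c] w"
    proof (rule computes.Mu)
      show "computes f [w, c] 0" using f[of w c] * by simp
      show "\<forall>v<w. \<exists>y>0. computes f [v, c] y"
      proof (intro allI impI exI conjI)
        fix v assume "v < w"
        then show "computes f [v, c] 1" using f[of v c] * by simp
      qed simp
    qed
  qed
  have h: "computes (Comp g [Mu f, Proj 0]) [c] z \<longleftrightarrow> (\<exists>w. P w c \<and> (\<forall>v<w. \<not> P v c) \<and> z = out w c)" for c z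
  proof
    assume "computes (Comp g [Mu f, Proj 0]) [c] z"
    then obtain ys where ys: "list_all2 (\<lambda>h y. computes h [c] y) [Mu f, Proj 0] ys" "computes g ys z"
      by (auto elim: computesE)
    then obtain w c' where w: "ys = [w, c']" "computes (Mu f) [c] w" and "computes (Proj 0) [c] c'"
      by (auto simp: list_all2_Cons1)
    from this(3) have "c' = c" by (auto elim: computesE(3))
    with ys(2) w(1) have "computes g [w, c] z" by simp
    then have "z = out w c" using computes_deterministic g by blast
    then show "\<exists>w. P w c \<and> (\<forall>v<w. \<not> P v c) \<and> z = out w c"
      using Mu[of c w] w(2) by auto
  next
    assume "\<exists>w. P w c \<and> (\<forall>v<w. \<not> P v c) \<and> z = out w c"
    then obtain w where w: "computes (Mu f) [c] w" "z = out w c" using Mu by blast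
    show "computes (Comp g [Mu f, Proj 0]) [c] z"
      using w g computes.Proj[of 0 "[c]"] by (intro computes.Comp[where ys = "[w, c]"]) auto
  qed
  have least: "P w c \<and> (\<forall>v<w. \<not> P v c) \<longleftrightarrow> (\<exists>v. P v c) \<and> w = (LEAST v. P v c)" for w c
  proof
    assume w: "P w c \<and> (\<forall>v<w. \<not> P v c)"
    then have "(LEAST v. P v c) = w"
      by (intro Least_equality) (use w not_less in \<open>blast+\<close>)
    with w show "(\<exists>v. P v c) \<and> w = (LEAST v. P v c)" by blast
  next
    assume "(\<exists>v. P v c) \<and> w = (LEAST v. P v c)"
    then show "P w c \<and> (\<forall>v<w. \<not> P v c)"
      using LeastI_ex[of "\<lambda>v. P v c"] not_less_Least[of _ "\<lambda>v. P v c"] by blast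
  qed
  have h': "computes (Comp g [Mu f, Proj 0]) [c] z \<longleftrightarrow>
      (\<exists>w. P w c) \<and> z = out (LEAST w. P w c) c" for c z
    unfolding h by (simp only: conj_assoc[symmetric] least) auto
  show ?thesis unfolding partial_computable_def
  proof (intro exI allI)
    fix p x
    have "inv str_code n = x \<longleftrightarrow> str_code x = n" for n by auto
    then show "(if \<exists>w. P w (str_code p)
      then Some (inv str_code (out (LEAST w. P w (str_code p)) (str_code p))) else None) = Some x
      \<longleftrightarrow> computes (Comp g [Mu f, Proj 0]) [str_code p] (str_code x)"
      unfolding h' by simp
  qed
qed

text \<open>The floor of the binary logarithm of \<open>Suc c\<close>: strings of length
  \<open>n\<close> have exactly the codes from \<open>2 ^ n - 1\<close> to
  \<open>2 ^ Suc n - 2\<close>. The bounded sum shows it to be recursive.\<close>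

definition code_length :: "nat \<Rightarrow> nat" where
  "code_length c = (\<Sum>k<c. of_bool (2 ^ Suc k \<le> Suc c))"

lemma str_code_bounds: "2 ^ length x \<le> Suc (str_code x)" "Suc (str_code x) < 2 ^ Suc (length x)"
proof -
  have "2 ^ length x \<le> Suc (str_code x) \<and> Suc (str_code x) < 2 ^ Suc (length x)"
  proof (induction x)
    case (Cons b x)
    have "str_code (b # x) = 2 * str_code x + (if b then 2 else 1)" by simp
    moreover have "(2::nat) ^ length (b # x) = 2 * 2 ^ length x" by simp
    moreover have "(2::nat) ^ Suc (length (b # x)) = 2 * 2 ^ Suc (length x)" by simp
    ultimately show ?case using Cons.IH by (auto split: if_splits)
  qed simp
  then show "2 ^ length x \<le> Suc (str_code x)" "Suc (str_code x) < 2 ^ Suc (length x)" by simp_all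
qed

lemma code_length_eqI:
  assumes "2 ^ n \<le> Suc c" "Suc c < 2 ^ Suc n"
  shows "code_length c = n"
proof -
  have iff: "2 ^ Suc k \<le> Suc c \<longleftrightarrow> k < n" for k
  proof
    assume "2 ^ Suc k \<le> Suc c"
    also note assms(2)
    finally have "Suc k < Suc n" by (rule power_less_imp_less_exp[rotated]) simp
    then show "k < n" by simp
  next
    assume "k < n"
    then have "(2::nat) ^ Suc k \<le> 2 ^ n" by (intro power_increasing) auto
    also note assms(1)
    finally show "2 ^ Suc k \<le> Suc c" .
  qed
  have "n \<le> c" using less_le_trans[OF less_exp assms(1)] by simp
  then have "{..<c} \<inter> {k. k < n} = {..<n}" by auto
  then show ?thesis unfolding code_length_def iff by simp
qed

lemma code_length_str_code [simp]: "code_length (str_code x) = length x"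
  by (rule code_length_eqI) (rule str_code_bounds)+

lemma recursive_code_length [recursive_intros]:
  assumes "recursive F"
  shows "recursive (\<lambda>e. code_length (F e))"
  unfolding code_length_def
  using assms recursive_shift[OF assms, of 1] by (intro recursive_intros) auto

text \<open>The floor of the square root, used to decode pairs: if \<open>w = k * k + x\<close> with
  \<open>x \<le> 2 * k\<close>, then \<open>isqrt w = k\<close>.\<close>

definition isqrt :: "nat \<Rightarrow> nat" where
  "isqrt w = (\<Sum>i<w. of_bool (Suc i * Suc i \<le> w))"

lemma isqrt_eqI:
  assumes "k * k \<le> w" "w < Suc k * Suc k"
  shows "isqrt w = k"
proof -
  have iff: "Suc i * Suc i \<le> w \<longleftrightarrow> i < k" for i
  proof
    assume "Suc i * Suc i \<le> w"
    then have "Suc i * Suc i < Suc k * Suc k" using assms by linarith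
    then show "i < k" by (meson Suc_less_eq mult_le_mono not_less)
  next
    assume "i < k"
    then have "Suc i * Suc i \<le> k * k" by (intro mult_le_mono) auto
    then show "Suc i * Suc i \<le> w" using assms by linarith
  qed
  have "k \<le> w" using assms(1) le_square[of k] by linarith
  then have "{..<w} \<inter> {i. i < k} = {..<k}" by auto
  then show ?thesis unfolding isqrt_def iff by simp
qed

lemma recursive_isqrt [recursive_intros]:
  assumes "recursive F"
  shows "recursive (\<lambda>e. isqrt (F e))"
  unfolding isqrt_def
  using assms recursive_shift[OF assms, of 1] by (intro recursive_intros) auto

lemma complexity_le: "V p = Some x \<Longrightarrow> complexity V x \<le> enat (length p)"
  unfolding complexity_def by (rule INF_lower) simp

lemma complexity_less_iff: "complexity V x < enat s \<longleftrightarrow> (\<exists>p. V p = Some x \<and> length p < s)"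
  unfolding complexity_def by (simp add: Inf_less_iff)

text \<open>A program for the \<open>i\<close>-th enumerated element at level \<open>l\<close> is the \<open>i\<close>-th string of length \<open>l\<close>.\<close>

lemma complexity_enumeration:
  assumes R: "decidable (\<lambda>e. R (e 0) (e 1) (e 2))"
    and fin: "\<And>l. finite {x. \<exists>t. R l x t}" and card: "\<And>l. card {x. \<exists>t. R l x t} \<le> 2 ^ l"
  shows "\<exists>V. partial_computable V \<and> (\<forall>l x t. R l (str_code x) t \<longrightarrow> complexity V x \<le> enat l)"
proof -
  \<comment> \<open>A number \<open>w\<close> is read as a pair: its integer square root bounds the
    stages inspected, the remainder is the string code tested.\<close>
  define x_of where "x_of w = w - isqrt w * isqrt w" for w
  define hit where "hit l w \<longleftrightarrow> (\<exists>t<Suc (isqrt w). R l (x_of w) t)" for l w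
  \<comment> \<open>Only the first witness of a string code counts, so every enumerated element of
    level \<open>l\<close> has exactly one rank.\<close>
  define new where "new l w \<longleftrightarrow> hit l w \<and> (\<forall>v<w. \<not> (x_of v = x_of w \<and> hit l v))" for l w
  define rank where "rank l w = (\<Sum>v<w. of_bool (new l v) :: nat)" for l w
  \<comment> \<open>\<open>Suc c - 2 ^ code_length c\<close> is the index, from 0, of the string
    with code \<open>c\<close> among the strings of its length.\<close>
  define P where "P w c \<longleftrightarrow> new (code_length c) w \<and> rank (code_length c) w = Suc c - 2 ^ code_length c" for w c
  define V where "V p = (if \<exists>w. P w (str_code p)
    then Some (inv str_code (x_of (LEAST w. P w (str_code p)))) else None)" for p
  have x_of [recursive_intros]: "recursive (\<lambda>e. x_of (F e))" if "recursive F" for F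
    unfolding x_of_def by (intro recursive_intros that)
  have R' [recursive_intros]: "decidable (\<lambda>e. R (A e) (B e) (C e))"
    if "recursive A" "recursive B" "recursive C" for A B C
  proof -
    define G where "G i = (if i = 0 then A else if i = (1::nat) then B else C)" for i
    have "recursive (G i)" for i using that by (simp add: G_def)
    from recursive_subst[OF R[unfolded decidable_def], of G, OF this] show ?thesis
      by (simp add: decidable_def G_def)
  qed
  have hit [recursive_intros]: "decidable (\<lambda>e. hit (A e) (B e))" if "recursive A" "recursive B" for A B
    unfolding hit_def using recursive_shift[OF that(1), of 1] recursive_shift[OF that(2), of 1] that
    by (intro recursive_intros) auto
  have new [recursive_intros]: "decidable (\<lambda>e. new (A e) (B e))" if "recursive A" "recursive B" for A B
    unfolding new_def using recursive_shift[OF that(1), of 1] recursive_shift[OF that(2), of 1] that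
    by (intro recursive_intros) auto
  have rank [recursive_intros]: "recursive (\<lambda>e. rank (A e) (B e))" if "recursive A" "recursive B" for A B
    unfolding rank_def using recursive_shift[OF that(1), of 1] that
    by (intro recursive_intros) auto
  have "partial_computable V"
    unfolding V_def
  proof (rule partial_computable_search)
    show "decidable (\<lambda>e. P (e 0) (e 1))"
      unfolding P_def by (intro recursive_intros)
    show "recursive (\<lambda>e. x_of (e 0))" by (intro recursive_intros)
  qed
  moreover have "complexity V x \<le> enat l" if R: "R l (str_code x) t" for l x t
  proof -
    \<comment> \<open>Both bounds matter: \<open>str_code x \<le> k\<close> lets the pair be
      decoded, and \<open>t \<le> k\<close> puts the stage within the inspected range.\<close>
    define k where "k = max (str_code x) t"
    have "isqrt (k * k + str_code x) = k"
      by (rule isqrt_eqI) (auto simp: k_def)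
    then have "hit l (k * k + str_code x)" "x_of (k * k + str_code x) = str_code x"
      using R by (auto simp: hit_def x_of_def k_def intro!: exI[of _ t])
    then have ex: "\<exists>w. hit l w \<and> x_of w = str_code x" by blast
    define w where "w = (LEAST w. hit l w \<and> x_of w = str_code x)"
    have w: "hit l w" "x_of w = str_code x"
      using LeastI_ex[OF ex] by (auto simp: w_def)
    moreover have "\<not> (hit l v \<and> x_of v = str_code x)" if "v < w" for v
      using not_less_Least that unfolding w_def by blast
    ultimately have new_w: "new l w" by (auto simp: new_def)
    have rank_eq: "rank l v = card {u. u < v \<and> new l u}" for v
      by (simp add: rank_def Int_def)
    \<comment> \<open>Different new witnesses carry different string codes, so a rank stays below
      the cardinality of the level, which is at most \<open>2 ^ l\<close>.\<close>
    have inj: "inj_on x_of {v. new l v}"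
    proof (rule inj_onI)
      fix u v assume "u \<in> {v. new l v}" "v \<in> {v. new l v}" "x_of u = x_of v"
      then show "u = v" by (cases u v rule: linorder_cases) (auto simp: new_def)
    qed
    have "rank l w < card {u. u \<le> w \<and> new l u}"
      unfolding rank_eq using new_w by (intro psubset_card_mono) auto
    also have "\<dots> = card (x_of ` {u. u \<le> w \<and> new l u})"
      by (intro card_image[symmetric] inj_on_subset[OF inj]) auto
    also have "\<dots> \<le> card {x. \<exists>t. R l x t}"
      by (intro card_mono fin) (auto simp: new_def hit_def)
    also have "\<dots> \<le> 2 ^ l" by (rule card)
    finally have rank_w: "rank l w < 2 ^ l" .
    define c where "c = 2 ^ l - 1 + rank l w"
    have c: "Suc c = 2 ^ l + rank l w" by (simp add: c_def)
    then have len: "code_length c = l" using rank_w by (intro code_length_eqI) auto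
    define p where "p = inv str_code c"
    have p: "str_code p = c" by (simp add: p_def)
    have P_iff: "P v c \<longleftrightarrow> v = w" for v
    proof
      assume "P v c"
      then have v: "new l v" "rank l v = rank l w" by (auto simp: P_def len c)
      have "rank l a < rank l b" if "a < b" "new l a" for a b
        unfolding rank_eq using that by (intro psubset_card_mono) auto
      then show "v = w" using v new_w by (cases v w rule: linorder_cases) fastforce+
    qed (simp add: P_def len c new_w)
    have "(LEAST v. v = w) = w" by (rule Least_equality) auto
    then have "V p = Some x" using w by (simp add: V_def P_iff p)
    moreover have "length p = l" using code_length_str_code[of p] by (simp add: p len)
    ultimately show ?thesis using complexity_le[of V p x] by simp
  qed
  ultimately show ?thesis by blast
qed

subsection \<open>A hypercontractive inequality for sets\<close>

text \<open>The probability that independent flips turn \<open>x\<close> into \<open>y\<close>,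
  where position \<open>i\<close> is flipped with probability \<open>\<epsilon> i\<close>.\<close>

definition noise_weight :: "(nat \<Rightarrow> real) \<Rightarrow> bool list \<Rightarrow> bool list \<Rightarrow> real" where
  "noise_weight \<epsilon> x y = (\<Prod>i<length x. if x ! i = y ! i then 1 - \<epsilon> i else \<epsilon> i)"

definition noise_prob :: "(nat \<Rightarrow> real) \<Rightarrow> bool list set \<Rightarrow> bool list \<Rightarrow> real" where
  "noise_prob \<epsilon> A x = (\<Sum>y\<in>A. noise_weight \<epsilon> x y)"

lemma noise_weight_Cons:
  "noise_weight \<epsilon> (a # x) (b # y) = (if a = b then 1 - \<epsilon> 0 else \<epsilon> 0) * noise_weight (\<epsilon> \<circ> Suc) x y"
  by (simp add: noise_weight_def prod.lessThan_Suc_shift o_def del: prod.lessThan_Suc)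

lemma noise_weight_nonneg:
  assumes "\<And>i. i < length x \<Longrightarrow> 0 \<le> \<epsilon> i \<and> \<epsilon> i \<le> 1"
  shows "0 \<le> noise_weight \<epsilon> x y"
  unfolding noise_weight_def using assms by (intro prod_nonneg) auto

lemma finite_lists_length: "finite {x :: bool list. length x = n}"
  using finite_lists_length_eq[of "UNIV :: bool set" n] by simp

lemma lists_length_Suc:
  "{x :: bool list. length x = Suc n} = (#) True ` {x. length x = n} \<union> (#) False ` {x. length x = n}"
proof (intro equalityI subsetI)
  fix x :: "bool list" assume "x \<in> {x. length x = Suc n}"
  then obtain b y where "x = b # y" "length y = n" by (auto simp: length_Suc_conv)
  then show "x \<in> (#) True ` {x. length x = n} \<union> (#) False ` {x. length x = n}" by (cases b) auto
qed auto

lemma sum_lists_length_Suc: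
  fixes f :: "bool list \<Rightarrow> real"
  shows "(\<Sum>x | length x = Suc n. f x) = (\<Sum>x | length x = n. f (True # x) + f (False # x))"
proof -
  have "(\<Sum>x | length x = Suc n. f x)
      = sum f ((#) True ` {x. length x = n}) + sum f ((#) False ` {x. length x = n})"
    unfolding lists_length_Suc
    by (rule sum.union_disjoint) (auto intro!: finite_imageI finite_lists_length)
  then show ?thesis by (simp add: sum.reindex sum.distrib)
qed

text \<open>A concave power lies below its tangent at 1 (Bernoulli), here a case of the weighted
  arithmetic-geometric mean inequality.\<close>

lemma powr_le_affine:
  fixes x \<eta> :: real
  assumes "0 \<le> x" "0 \<le> \<eta>" "\<eta> \<le> 1"
  shows "x powr \<eta> \<le> 1 + \<eta> * (x - 1)"
proof (cases "x = 0 \<or> \<eta> = 0")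
  case True
  then show ?thesis using assms by (auto simp: powr_def)
next
  case False
  then have "x > 0" using assms by simp
  have "x powr \<eta> * 1 powr (1 - \<eta>) \<le> \<eta> * x + (1 - \<eta>) * 1"
    using assms \<open>x > 0\<close> by (intro Youngs_inequality_0) auto
  then show ?thesis by (simp add: algebra_simps)
qed

text \<open>The case of mean 1 in the two-point inequality. The power sum exceeds 2 by at most
  \<open>2 * \<eta> * h\<^sup>2\<close>, while the geometric mean falls short of 1 by at least
  \<open>h\<^sup>2 / 2\<close>; since \<open>\<eta> \<le> q\<close>, the loss outweighs the
  gain.\<close>

lemma two_point_normalized:
  fixes h q \<eta> :: real
  assumes "0 \<le> \<eta>" "\<eta> \<le> q" "q \<le> 1/4" "\<bar>h\<bar> \<le> 1"
  shows "(1 - 2 * q) * ((1 + h) powr (1 + \<eta>) + (1 - h) powr (1 + \<eta>))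
    + 4 * q * sqrt ((1 + h) powr (1 + \<eta>) * (1 - h) powr (1 + \<eta>)) \<le> 2"
proof -
  have pow: "(1 + k) powr (1 + \<eta>) \<le> (1 + k) * (1 + \<eta> * k)" if "\<bar>k\<bar> \<le> 1" for k
  proof (cases "k = -1")
    case False
    then have "1 + k > 0" using that by linarith
    then have "(1 + k) powr (1 + \<eta>) = (1 + k) * (1 + k) powr \<eta>" by (simp add: powr_add)
    also have "(1 + k) powr \<eta> \<le> 1 + \<eta> * k"
      using powr_le_affine[of "1 + k" \<eta>] assms that by simp
    finally show ?thesis using \<open>1 + k > 0\<close> by simp
  qed simp
  have "(1 + h) powr (1 + \<eta>) + (1 - h) powr (1 + \<eta>) \<le> (1 + h) * (1 + \<eta> * h) + (1 - h) * (1 - \<eta> * h)"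
    using pow[of h] pow[of "-h"] assms(4) by simp
  also have "\<dots> = 2 + 2 * \<eta> * h\<^sup>2" by (simp add: algebra_simps power2_eq_square)
  finally have 1: "(1 + h) powr (1 + \<eta>) + (1 - h) powr (1 + \<eta>) \<le> 2 + 2 * \<eta> * h\<^sup>2" .
  have h2: "h\<^sup>2 \<le> 1" using assms(4) by (simp add: abs_square_le_1)
  have "(1 + h) powr (1 + \<eta>) * (1 - h) powr (1 + \<eta>) = (1 - h\<^sup>2) powr (1 + \<eta>)"
    using assms(4) by (subst powr_mult[symmetric]) (auto simp: algebra_simps power2_eq_square)
  \<comment> \<open>The base lies between 0 and 1, so lowering the exponent to 1 enlarges the power;
    the bound by a perfect square then removes the square root.\<close>
  also have "\<dots> \<le> (1 - h\<^sup>2) powr 1"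
    using assms h2 by (intro powr_mono') auto
  also have "\<dots> \<le> (1 - h\<^sup>2 / 2)\<^sup>2"
  proof -
    have "(1 - h\<^sup>2 / 2)\<^sup>2 = 1 - h\<^sup>2 + (h\<^sup>2)\<^sup>2 / 4"
      by (simp add: power2_eq_square field_simps)
    then show ?thesis using h2 by simp
  qed
  finally have "sqrt ((1 + h) powr (1 + \<eta>) * (1 - h) powr (1 + \<eta>)) \<le> 1 - h\<^sup>2 / 2"
    using h2 by (intro real_le_lsqrt) auto
  note 2 = this
  have "(1 - 2 * q) * ((1 + h) powr (1 + \<eta>) + (1 - h) powr (1 + \<eta>))
      + 4 * q * sqrt ((1 + h) powr (1 + \<eta>) * (1 - h) powr (1 + \<eta>))
    \<le> (1 - 2 * q) * (2 + 2 * \<eta> * h\<^sup>2) + 4 * q * (1 - h\<^sup>2 / 2)"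
    using assms by (intro add_mono mult_left_mono[OF 1] mult_left_mono[OF 2]) auto
  also have "\<dots> = 2 + 2 * h\<^sup>2 * ((\<eta> - q) - 2 * q * \<eta>)" by (simp add: algebra_simps)
  also have "\<dots> \<le> 2"
  proof -
    have "0 \<le> q * \<eta>" using assms by simp
    then have "(\<eta> - q) - 2 * q * \<eta> \<le> 0" using assms by linarith
    then show ?thesis using mult_nonneg_nonpos[of "2 * h\<^sup>2"] by fastforce
  qed
  finally show ?thesis .
qed

text \<open>Both sides are homogeneous of degree \<open>1 + \<eta>\<close>, so dividing by the mean
  \<open>s\<close> reduces to the normalized case. In the induction over the length,
  \<open>a\<close> and \<open>b\<close> are the sizes of the two halves of a set, split by first
  bit.\<close>

lemma two_point:
  fixes a b q \<eta> :: real
  assumes "0 \<le> \<eta>" "\<eta> \<le> q" "q \<le> 1/4" "0 \<le> a" "0 \<le> b"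
  shows "(1 - 2 * q) * (a powr (1 + \<eta>) + b powr (1 + \<eta>))
    + 4 * q * sqrt (a powr (1 + \<eta>) * b powr (1 + \<eta>)) \<le> 2 powr (-\<eta>) * (a + b) powr (1 + \<eta>)"
proof (cases "a + b = 0")
  case False
  define s where "s = (a + b) / 2"
  define h where "h = (a - b) / (a + b)"
  have s: "s > 0" using False assms by (simp add: s_def)
  have h: "\<bar>h\<bar> \<le> 1" using assms False by (simp add: h_def divide_le_eq abs_le_iff)
  have a: "a = s * (1 + h)" and b: "b = s * (1 - h)"
    using False by (simp_all add: s_def h_def field_simps)
  define S where "S = s powr (1 + \<eta>)"
  have pa: "a powr (1 + \<eta>) = S * (1 + h) powr (1 + \<eta>)" and pb: "b powr (1 + \<eta>) = S * (1 - h) powr (1 + \<eta>)"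
    unfolding a b S_def using s h by (auto simp: powr_mult)
  have S: "S \<ge> 0" by (simp add: S_def)
  have sq: "sqrt (a powr (1 + \<eta>) * b powr (1 + \<eta>)) = S * sqrt ((1 + h) powr (1 + \<eta>) * (1 - h) powr (1 + \<eta>))"
  proof -
    have "a powr (1 + \<eta>) * b powr (1 + \<eta>) = S\<^sup>2 * ((1 + h) powr (1 + \<eta>) * (1 - h) powr (1 + \<eta>))"
      unfolding pa pb by (simp add: power2_eq_square)
    then show ?thesis using S by (simp add: real_sqrt_mult)
  qed
  have "(1 - 2 * q) * (a powr (1 + \<eta>) + b powr (1 + \<eta>)) + 4 * q * sqrt (a powr (1 + \<eta>) * b powr (1 + \<eta>))
      = S * ((1 - 2 * q) * ((1 + h) powr (1 + \<eta>) + (1 - h) powr (1 + \<eta>))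
        + 4 * q * sqrt ((1 + h) powr (1 + \<eta>) * (1 - h) powr (1 + \<eta>)))"
    unfolding sq unfolding pa pb by (simp add: algebra_simps)
  also have "\<dots> \<le> S * 2"
    using two_point_normalized[OF assms(1-3) h] S by (intro mult_left_mono)
  also have "\<dots> = 2 powr (-\<eta>) * (a + b) powr (1 + \<eta>)"
  proof -
    have "a + b = 2 * s" by (simp add: s_def)
    then have "2 powr (-\<eta>) * (a + b) powr (1 + \<eta>) = (2 powr (-\<eta>) * 2 powr (1 + \<eta>)) * S"
      using s by (simp add: powr_mult S_def)
    also have "(2::real) powr (-\<eta>) * 2 powr (1 + \<eta>) = 2"
      by (simp add: powr_add[symmetric])
    finally show ?thesis by simp
  qed
  finally show ?thesis .
next
  case True
  then have "a = 0" "b = 0" using assms by auto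
  then show ?thesis by simp
qed

text \<open>Induction on the length, splitting \<open>A\<close> by its first bit: the induction
  hypothesis bounds the squares for each half, Cauchy-Schwarz bounds the mixed term, and the
  two-point inequality recombines the halves.\<close>

theorem noise_hypercontractive:
  assumes "A \<subseteq> {y. length y = n}" and "0 \<le> \<eta>"
    and "\<And>i. i < n \<Longrightarrow> 0 \<le> \<epsilon> i \<and> \<epsilon> i \<le> 1 \<and> \<eta> \<le> \<epsilon> i * (1 - \<epsilon> i)"
  shows "(\<Sum>x | length x = n. (noise_prob \<epsilon> A x)\<^sup>2) \<le> real (card A) powr (1 + \<eta>) * 2 powr (- (n * \<eta>))"
  using assms
proof (induction n arbitrary: A \<epsilon>)
  case 0
  then consider "A = {}" | "A = {[]}" by auto
  then show ?case
    by cases (auto simp: noise_prob_def noise_weight_def)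
next
  case (Suc n)
  define A' where "A' c = {y. c # y \<in> A}" for c
  define e where "e = \<epsilon> 0"
  \<comment> \<open>The variance of one flip. Averaging \<open>a\<close> and \<open>b\<close> with
    weights \<open>1 - e\<close>, \<open>e\<close> in both orders and adding the squares gives
    \<open>(1 - 2 * q) * (a\<^sup>2 + b\<^sup>2) + 4 * q * a * b\<close>.\<close>
  define q where "q = e * (1 - e)"
  define u where "u c x = noise_prob (\<epsilon> \<circ> Suc) (A' c) x" for c x
  define N where "N c = real (card (A' c)) powr (1 + \<eta>)" for c
  define K where "K = 2 powr (- (real n * \<eta>))"
  have e: "0 \<le> e" "e \<le> 1" "\<eta> \<le> q" using Suc.prems(3)[of 0] by (auto simp: e_def q_def)
  have q: "0 \<le> q" "q \<le> 1/4"
  proof -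
    show "0 \<le> q" using e Suc.prems(2) by linarith
    have "0 \<le> (e - 1/2)\<^sup>2" by simp
    then show "q \<le> 1/4" by (simp add: q_def power2_eq_square algebra_simps)
  qed
  have len: "A' c \<subseteq> {y. length y = n}" for c using Suc.prems(1) by (auto simp: A'_def)
  have fin: "finite (A' c)" for c using len finite_lists_length by (rule finite_subset)
  have A: "A = (#) True ` A' True \<union> (#) False ` A' False"
  proof (intro equalityI subsetI)
    fix x assume "x \<in> A"
    moreover from this obtain b y where "x = b # y"
      using Suc.prems(1) by (auto simp: length_Suc_conv)
    ultimately show "x \<in> (#) True ` A' True \<union> (#) False ` A' False"
      by (cases b) (auto simp: A'_def)
  qed (auto simp: A'_def)
  have card_A: "card A = card (A' True) + card (A' False)"
    by (subst A, subst card_Un_disjoint) (auto simp: fin card_image)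
  have np: "noise_prob \<epsilon> A (c # x) = (1 - e) * u c x + e * u (\<not> c) x" for c x
  proof -
    have "noise_prob \<epsilon> A (c # x) = (\<Sum>y\<in>A' True. noise_weight \<epsilon> (c # x) (True # y))
        + (\<Sum>y\<in>A' False. noise_weight \<epsilon> (c # x) (False # y))"
      unfolding noise_prob_def by (subst A, subst sum.union_disjoint) (auto simp: fin sum.reindex)
    then show ?thesis
      by (cases c) (simp_all add: noise_weight_Cons u_def noise_prob_def sum_distrib_left e_def)
  qed
  have IH: "(\<Sum>x | length x = n. (u c x)\<^sup>2) \<le> N c * K" for c
    unfolding u_def N_def K_def using Suc.prems
    by (intro Suc.IH[OF len Suc.prems(2)]) auto
  have N: "0 \<le> N c" for c by (simp add: N_def)
  have K: "0 \<le> K" by (simp add: K_def)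
  have cross: "(\<Sum>x | length x = n. u True x * u False x) \<le> K * sqrt (N True * N False)"
  proof -
    have "(\<Sum>x | length x = n. u True x * u False x)\<^sup>2
        \<le> (\<Sum>x | length x = n. (u True x)\<^sup>2) * (\<Sum>x | length x = n. (u False x)\<^sup>2)"
      by (rule Cauchy_Schwarz_ineq_sum)
    also have "\<dots> \<le> (N True * K) * (N False * K)"
      using IH N K by (intro mult_mono) (auto intro: sum_nonneg)
    also have "\<dots> = K\<^sup>2 * (N True * N False)" by (simp add: power2_eq_square)
    finally have "(\<Sum>x | length x = n. u True x * u False x) \<le> sqrt (K\<^sup>2 * (N True * N False))"
      by (rule real_le_rsqrt)
    then show ?thesis using K by (simp add: real_sqrt_mult)
  qed
  have "(\<Sum>x | length x = Suc n. (noise_prob \<epsilon> A x)\<^sup>2)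
      = (\<Sum>x | length x = n. (1 - 2 * q) * ((u True x)\<^sup>2 + (u False x)\<^sup>2) + 4 * q * (u True x * u False x))"
    unfolding sum_lists_length_Suc np q_def
    by (intro sum.cong refl) (simp add: power2_eq_square algebra_simps)
  also have "\<dots> = (1 - 2 * q) * ((\<Sum>x | length x = n. (u True x)\<^sup>2) + (\<Sum>x | length x = n. (u False x)\<^sup>2))
      + 4 * q * (\<Sum>x | length x = n. u True x * u False x)"
    by (simp only: sum.distrib sum_distrib_left[symmetric])
  also have "\<dots> \<le> (1 - 2 * q) * (N True * K + N False * K) + 4 * q * (K * sqrt (N True * N False))"
    using IH cross q by (intro add_mono mult_left_mono) auto
  also have "\<dots> = K * ((1 - 2 * q) * (N True + N False) + 4 * q * sqrt (N True * N False))"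
    by (simp add: algebra_simps)
  also have "\<dots> \<le> K * (2 powr (-\<eta>) * (real (card (A' True)) + real (card (A' False))) powr (1 + \<eta>))"
    unfolding N_def using Suc.prems(2) e q K by (intro mult_left_mono two_point) auto
  also have "\<dots> = real (card A) powr (1 + \<eta>) * 2 powr (- (real (Suc n) * \<eta>))"
  proof -
    have "2 powr (- (real (Suc n) * \<eta>)) = 2 powr (- (real n * \<eta>)) * 2 powr (-\<eta>)"
      by (simp add: powr_add[symmetric] algebra_simps)
    then show ?thesis by (simp add: K_def card_A)
  qed
  finally show ?case .
qed

text \<open>Chebyshev's argument: each counted string contributes at least
  \<open>\<theta>\<^sup>2\<close> to the sum of squares.\<close>

lemma card_noise_prob_ge:
  assumes "A \<subseteq> {y. length y = n}" and "0 \<le> \<eta>" and "0 < \<theta>"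
    and "\<And>i. i < n \<Longrightarrow> 0 \<le> \<epsilon> i \<and> \<epsilon> i \<le> 1 \<and> \<eta> \<le> \<epsilon> i * (1 - \<epsilon> i)"
    and "real (card A) \<le> 2 powr s"
  shows "real (card {x. length x = n \<and> \<theta> \<le> noise_prob \<epsilon> A x}) \<le> 2 powr (s * (1 + \<eta>) - n * \<eta>) / \<theta>\<^sup>2"
proof -
  let ?B = "{x. length x = n \<and> \<theta> \<le> noise_prob \<epsilon> A x}"
  have "real (card ?B) * \<theta>\<^sup>2 = (\<Sum>x\<in>?B. \<theta>\<^sup>2)" by simp
  also have "\<dots> \<le> (\<Sum>x\<in>?B. (noise_prob \<epsilon> A x)\<^sup>2)"
    using assms(3) by (intro sum_mono power_mono) auto
  also have "\<dots> \<le> (\<Sum>x | length x = n. (noise_prob \<epsilon> A x)\<^sup>2)"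
    by (intro sum_mono2 finite_lists_length) auto
  also have "\<dots> \<le> real (card A) powr (1 + \<eta>) * 2 powr (- (n * \<eta>))"
    by (rule noise_hypercontractive[OF assms(1,2,4)])
  also have "\<dots> \<le> (2 powr s) powr (1 + \<eta>) * 2 powr (- (n * \<eta>))"
    using assms by (intro mult_right_mono powr_mono2) auto
  also have "\<dots> = 2 powr (s * (1 + \<eta>) - n * \<eta>)"
    by (simp add: powr_powr powr_diff powr_minus divide_inverse)
  finally show ?thesis using assms(3) by (simp add: pos_le_divide_eq)
qed

subsection \<open>Random noise on a sequence\<close>

lemma length_seq_prefix [simp]: "length (seq_prefix X n) = n"
  by (simp add: seq_prefix_def)

lemma nth_seq_prefix [simp]: "i < n \<Longrightarrow> seq_prefix X n ! i = X i"
  by (simp add: seq_prefix_def)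

lemma noise_prob_mono:
  assumes "A \<subseteq> B" "finite B" "\<And>i. i < length x \<Longrightarrow> 0 \<le> \<epsilon> i \<and> \<epsilon> i \<le> 1"
  shows "noise_prob \<epsilon> A x \<le> noise_prob \<epsilon> B x"
  unfolding noise_prob_def using assms by (intro sum_mono2 noise_weight_nonneg) auto

text \<open>The distributive law over independent bits; it turns the expectation of a product into a
  product of one-bit expectations.\<close>

lemma sum_prod_lists_length:
  fixes g :: "nat \<Rightarrow> bool \<Rightarrow> real"
  shows "(\<Sum>y | length y = n. \<Prod>i<n. g i (y ! i)) = (\<Prod>i<n. g i True + g i False)"
proof (induction n arbitrary: g)
  case (Suc n)
  have "(\<Sum>y | length y = Suc n. \<Prod>i<Suc n. g i (y ! i))
      = (\<Sum>y | length y = n. (g 0 True + g 0 False) * (\<Prod>i<n. g (Suc i) (y ! i)))"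
    unfolding sum_lists_length_Suc prod.lessThan_Suc_shift by (simp add: algebra_simps)
  also have "\<dots> = (g 0 True + g 0 False) * (\<Prod>i<n. g (Suc i) True + g (Suc i) False)"
    using Suc.IH[of "\<lambda>i. g (Suc i)"] by (simp add: sum_distrib_left[symmetric])
  finally show ?case unfolding prod.lessThan_Suc_shift .
qed simp

lemma hamming_eq_sum: "real (hamming x y) = (\<Sum>i<length x. if x ! i = y ! i then 0 else 1)"
proof -
  have "{i. i < length x \<and> x ! i \<noteq> y ! i} = {..<length x} \<inter> {i. x ! i \<noteq> y ! i}" by auto
  then show ?thesis by (simp add: hamming_def sum.If_cases Int_def)
qed

text \<open>Markov's inequality for \<open>2 ^ h\<close>, where \<open>h\<close> is the number of flipped bits.\<close>

lemma noise_prob_hamming_ge: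
  assumes \<epsilon>: "\<And>i. i < length x \<Longrightarrow> 0 \<le> \<epsilon> i \<and> \<epsilon> i \<le> 1"
  shows "noise_prob \<epsilon> {y. length y = length x \<and> r \<le> real (hamming x y)} x
    \<le> exp (\<Sum>i<length x. \<epsilon> i) / 2 powr r"
proof -
  let ?n = "length x"
  \<comment> \<open>A flip doubles \<open>2 ^ h\<close>, hence the factor 2 at a disagreement;
    summing out bit \<open>i\<close> leaves \<open>1 + \<epsilon> i\<close>.\<close>
  define g where "g i b = (if x ! i = b then 1 - \<epsilon> i else 2 * \<epsilon> i)" for i b
  have "noise_prob \<epsilon> {y. length y = ?n \<and> r \<le> real (hamming x y)} x * 2 powr r
      = (\<Sum>y | length y = ?n \<and> r \<le> real (hamming x y). noise_weight \<epsilon> x y * 2 powr r)"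
    by (simp add: noise_prob_def sum_distrib_right)
  also have "\<dots> \<le> (\<Sum>y | length y = ?n \<and> r \<le> real (hamming x y). noise_weight \<epsilon> x y * 2 powr real (hamming x y))"
    using \<epsilon> by (intro sum_mono mult_left_mono noise_weight_nonneg) auto
  also have "\<dots> \<le> (\<Sum>y | length y = ?n. noise_weight \<epsilon> x y * 2 powr real (hamming x y))"
    using \<epsilon> by (intro sum_mono2 finite_lists_length mult_nonneg_nonneg noise_weight_nonneg) auto
  also have "\<dots> = (\<Sum>y | length y = ?n. \<Prod>i<?n. g i (y ! i))"
  proof (intro sum.cong refl)
    fix y :: "bool list"
    have "2 powr real (hamming x y) = (\<Prod>i<?n. if x ! i = y ! i then 1 else 2)"
      unfolding hamming_eq_sum by (subst powr_sum) (auto intro!: prod.cong)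
    then show "noise_weight \<epsilon> x y * 2 powr real (hamming x y)
        = (\<Prod>i<?n. g i (y ! i))"
      unfolding noise_weight_def by (simp only: prod.distrib[symmetric]) (auto simp: g_def intro!: prod.cong)
  qed
  also have "\<dots> = (\<Prod>i<?n. 1 + \<epsilon> i)"
    unfolding sum_prod_lists_length by (intro prod.cong refl) (auto simp: g_def)
  also have "\<dots> \<le> (\<Prod>i<?n. exp (\<epsilon> i))"
    using \<epsilon> by (intro prod_mono) (auto intro: add_nonneg_nonneg exp_ge_add_one_self)
  also have "\<dots> = exp (\<Sum>i<?n. \<epsilon> i)" by (simp add: exp_sum)
  finally show ?thesis by (simp add: pos_le_divide_eq)
qed

lemma cesaro_mean_tendsto_zero:
  fixes f :: "nat \<Rightarrow> real"
  assumes "f \<longlonglongrightarrow> 0" and "\<And>i. 0 \<le> f i \<and> f i \<le> 1"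
  shows "(\<lambda>n. (\<Sum>i<n. f i) / real n) \<longlonglongrightarrow> 0"
proof (rule LIMSEQ_I)
  fix r :: real assume r: "r > 0"
  then obtain N where N: "\<And>n. n \<ge> N \<Longrightarrow> norm (f n - 0) < r / 2"
    using LIMSEQ_D[OF assms(1), of "r / 2"] by auto
  \<comment> \<open>From \<open>M\<close> on, the first \<open>N\<close> terms, which sum to at most
    \<open>N\<close>, contribute less than \<open>r / 2\<close> to the mean.\<close>
  obtain M where M: "2 * real N / r < real M" using reals_Archimedean2 by blast
  have "norm ((\<Sum>i<n. f i) / real n - 0) < r" if n: "n \<ge> Suc (max N M)" for n
  proof -
    have "(\<Sum>i<n. f i) = (\<Sum>i<N. f i) + (\<Sum>i=N..<n. f i)"
      using n by (simp add: lessThan_atLeast0 sum.atLeastLessThan_concat)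
    also have "(\<Sum>i<N. f i) \<le> (\<Sum>i<N. 1)" using assms(2) by (intro sum_mono) auto
    also have "(\<Sum>i=N..<n. f i) \<le> (\<Sum>i=N..<n. r / 2)"
      using N by (intro sum_mono) (force dest: N)
    also have "\<dots> \<le> real n * (r / 2)" using r by (simp add: mult_right_mono)
    finally have "(\<Sum>i<n. f i) \<le> real N + real n * (r / 2)" by simp
    also have "real N < real n * (r / 2)"
    proof -
      have "2 * real N < real M * r" using M r by (simp add: pos_divide_less_eq)
      also have "\<dots> \<le> real n * r" using n r by (intro mult_right_mono) auto
      finally show ?thesis by simp
    qed
    finally have "(\<Sum>i<n. f i) < r * real n" by (simp add: mult.commute)
    moreover have "0 \<le> (\<Sum>i<n. f i)" using assms(2) by (intro sum_nonneg) auto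
    ultimately show ?thesis using n by (simp add: pos_divide_less_eq)
  qed
  then show "\<exists>N. \<forall>n\<ge>N. norm ((\<Sum>i<n. f i) / real n - 0) < r" by blast
qed

section \<open>The product measure of the noisy sequence\<close>

locale bit_noise =
  fixes \<epsilon> :: "nat \<Rightarrow> real" and X :: "nat \<Rightarrow> bool"
  assumes flip_bounds: "\<And>i. 0 \<le> \<epsilon> i \<and> \<epsilon> i \<le> 1"
begin

text \<open>The law of the noisy bit itself, not of the flip: it agrees with \<open>X i\<close> with
  probability \<open>1 - \<epsilon> i\<close>.\<close>

definition bit_distr :: "nat \<Rightarrow> bool measure" where
  "bit_distr i = measure_pmf (bernoulli_pmf (if X i then 1 - \<epsilon> i else \<epsilon> i))"

sublocale product_prob_space bit_distr UNIV
  unfolding bit_distr_def by unfold_locales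

lemma sets_bit_distr [simp]: "sets (bit_distr i) = UNIV"
  and space_bit_distr [simp]: "space (bit_distr i) = UNIV"
  by (simp_all add: bit_distr_def)

lemma measure_bit_distr_singleton:
  "measure (bit_distr i) {b} = (if X i = b then 1 - \<epsilon> i else \<epsilon> i)"
  using flip_bounds[of i] by (cases b) (auto simp: bit_distr_def measure_pmf_single)

lemma seq_prefix_cylinder:
  assumes "length y = n"
  shows "{\<omega>. seq_prefix \<omega> n = y} = emb UNIV {..<n} (\<Pi>\<^sub>E i\<in>{..<n}. {y ! i})"
proof (rule set_eqI)
  fix \<omega>
  have "seq_prefix \<omega> n = y \<longleftrightarrow> (\<forall>i<n. \<omega> i = y ! i)"
    using assms by (simp add: list_eq_iff_nth_eq)
  moreover have "\<omega> \<in> emb UNIV {..<n} (\<Pi>\<^sub>E i\<in>{..<n}. {y ! i}) \<longleftrightarrow> (\<forall>i<n. \<omega> i = y ! i)"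
    unfolding prod_emb_def space_bit_distr PiE_UNIV_domain by (auto simp: restrict_PiE_iff)
  ultimately show "\<omega> \<in> {\<omega>. seq_prefix \<omega> n = y} \<longleftrightarrow> \<omega> \<in> emb UNIV {..<n} (\<Pi>\<^sub>E i\<in>{..<n}. {y ! i})"
    by blast
qed

lemma seq_prefix_cylinder_sets:
  assumes "length y = n"
  shows "{\<omega>. seq_prefix \<omega> n = y} \<in> sets (PiM UNIV bit_distr)"
  unfolding seq_prefix_cylinder[OF assms] by (rule sets_PiM_I) auto

lemma measure_seq_prefix_cylinder:
  assumes "length y = n"
  shows "measure (PiM UNIV bit_distr) {\<omega>. seq_prefix \<omega> n = y} = noise_weight \<epsilon> (seq_prefix X n) y"
proof -
  have "measure (PiM UNIV bit_distr) {\<omega>. seq_prefix \<omega> n = y} = (\<Prod>i<n. measure (bit_distr i) {y ! i})"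
    unfolding seq_prefix_cylinder[OF assms] by (rule measure_PiM_emb) auto
  then show ?thesis by (simp add: noise_weight_def measure_bit_distr_singleton)
qed

lemma measure_seq_prefix_event:
  assumes "A \<subseteq> {y. length y = n}"
  shows "{\<omega>. seq_prefix \<omega> n \<in> A} \<in> sets (PiM UNIV bit_distr)"
    and "measure (PiM UNIV bit_distr) {\<omega>. seq_prefix \<omega> n \<in> A} = noise_prob \<epsilon> A (seq_prefix X n)"
proof -
  have fin: "finite A" using assms finite_lists_length by (rule finite_subset)
  have eq: "{\<omega>. seq_prefix \<omega> n \<in> A} = (\<Union>y\<in>A. {\<omega>. seq_prefix \<omega> n = y})" by auto
  show "{\<omega>. seq_prefix \<omega> n \<in> A} \<in> sets (PiM UNIV bit_distr)"
    unfolding eq using assms by (intro sets.finite_UN fin seq_prefix_cylinder_sets) auto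
  have "measure (PiM UNIV bit_distr) {\<omega>. seq_prefix \<omega> n \<in> A}
      = (\<Sum>y\<in>A. measure (PiM UNIV bit_distr) {\<omega>. seq_prefix \<omega> n = y})"
    unfolding eq using assms
    by (intro finite_measure_finite_Union fin)
      (auto simp: disjoint_family_on_def intro!: seq_prefix_cylinder_sets)
  also have "\<dots> = noise_prob \<epsilon> A (seq_prefix X n)"
    unfolding noise_prob_def using assms by (intro sum.cong measure_seq_prefix_cylinder) auto
  finally show "measure (PiM UNIV bit_distr) {\<omega>. seq_prefix \<omega> n \<in> A} = noise_prob \<epsilon> A (seq_prefix X n)" .
qed

text \<open>The events that the prefix of length \<open>n\<close> falls into \<open>G n\<close> have
  summable probabilities, so almost every sequence lies in only finitely many of them, and a set of
  full measure is nonempty.\<close>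

lemma seq_prefix_Borel_Cantelli:
  assumes G: "\<And>n. G n \<subseteq> {y. length y = n}"
    and bound: "summable b" "\<forall>\<^sub>F n in sequentially. noise_prob \<epsilon> (G n) (seq_prefix X n) \<le> b n"
  shows "\<exists>Y. \<forall>\<^sub>F n in sequentially. seq_prefix Y n \<notin> G n"
proof -
  let ?P = "PiM UNIV bit_distr" and ?E = "\<lambda>n. {\<omega>. seq_prefix \<omega> n \<in> G n}"
  have "\<forall>\<^sub>F n in sequentially. norm (measure ?P (?E n)) \<le> b n"
    using bound(2) unfolding measure_seq_prefix_event(2)[OF G, symmetric] by simp
  then have "summable (\<lambda>n. measure ?P (?E n))"
    using bound(1) by (rule summable_comparison_test_ev)
  then have ae: "AE \<omega> in ?P. \<forall>\<^sub>F n in sequentially. \<omega> \<in> space ?P - ?E n"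
    by (intro borel_cantelli_AE1 measure_seq_prefix_event(1) G) (auto simp: emeasure_eq_measure)
  have "\<exists>Y. \<forall>\<^sub>F n in sequentially. Y \<in> space ?P - ?E n"
  proof (rule ccontr)
    assume *: "\<nexists>Y. \<forall>\<^sub>F n in sequentially. Y \<in> space ?P - ?E n"
    have "AE \<omega> in ?P. False"
      using ae by (rule eventually_mono) (use * in blast)
    then show False by simp
  qed
  then obtain Y where "\<forall>\<^sub>F n in sequentially. Y \<in> space ?P - ?E n" ..
  then show ?thesis by (auto elim: eventually_mono)
qed

end

text \<open>One application of Borel-Cantelli avoids two families simultaneously: the sets
  \<open>A n\<close>, and the sets \<open>F n\<close> of strings too far from the prefix of
  \<open>X\<close>. The distance allowed by \<open>F n\<close> is sublinear because the means of
  \<open>\<epsilon>\<close> tend to 0.\<close>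

theorem (in bit_noise) noisy_sequence_exists:
  assumes "\<epsilon> \<longlonglongrightarrow> 0" and A: "\<And>n. A n \<subseteq> {y. length y = n}"
    and small: "\<forall>\<^sub>F n in sequentially. noise_prob \<epsilon> (A n) (seq_prefix X n) \<le> 1 / (real n + 1)\<^sup>2"
  shows "\<exists>Y. (\<forall>\<^sub>F n in sequentially. seq_prefix Y n \<notin> A n) \<and> besicovitch_dist X Y = 0"
proof -
  \<comment> \<open>The first term makes \<open>2 powr r n\<close> absorb \<open>exp S\<close> for
    \<open>S = (\<Sum>i<n. \<epsilon> i)\<close>, as \<open>2 * ln 2 \<ge> 1\<close>; the second
    leaves the summable factor \<open>1 / (real n + 1)\<^sup>2\<close>.\<close>
  define r where "r n = 2 * (\<Sum>i<n. \<epsilon> i) + 2 * log 2 (real n + 1)" for n :: nat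
  define F where "F n = {y. length y = n \<and> r n \<le> real (hamming (seq_prefix X n) y)}" for n
  have F: "noise_prob \<epsilon> (F n) (seq_prefix X n) \<le> 1 / (real n + 1)\<^sup>2" for n
  proof -
    define S where "S = (\<Sum>i<n. \<epsilon> i)"
    have S: "0 \<le> S" unfolding S_def using flip_bounds by (intro sum_nonneg) auto
    have "noise_prob \<epsilon> (F n) (seq_prefix X n) \<le> exp S / 2 powr r n"
      using noise_prob_hamming_ge[of "seq_prefix X n" \<epsilon> "r n"] flip_bounds by (simp add: F_def S_def)
    also have "2 powr r n = 2 powr (2 * S) * 2 powr (2 * log 2 (real n + 1))"
      by (simp add: r_def S_def powr_add)
    also have "2 powr (2 * log 2 (real n + 1)) = (real n + 1)\<^sup>2"
    proof -
      have "2 powr (2 * log 2 (real n + 1)) = (2 powr log 2 (real n + 1)) powr 2"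
        by (simp only: powr_powr mult.commute)
      also have "2 powr log 2 (real n + 1) = real n + 1" by (rule powr_log_cancel) auto
      also have "(real n + 1) powr 2 = (real n + 1)\<^sup>2" by (rule powr_numeral) simp
      finally show ?thesis .
    qed
    also have "exp S / (2 powr (2 * S) * (real n + 1)\<^sup>2) \<le> 1 / (real n + 1)\<^sup>2"
    proof -
      have "exp S \<le> 2 powr (2 * S)"
        using mult_left_mono[of 1 "2 * ln 2" S] ln2_ge_two_thirds S
        by (simp add: powr_def mult_ac)
      then show ?thesis by (simp add: divide_simps)
    qed
    finally show ?thesis .
  qed
  have "\<exists>Y. \<forall>\<^sub>F n in sequentially. seq_prefix Y n \<notin> A n \<union> F n"
  proof (rule seq_prefix_Borel_Cantelli)
    show "A n \<union> F n \<subseteq> {y. length y = n}" for n using A by (auto simp: F_def)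
    have "summable (\<lambda>n. 1 / real (Suc n) ^ 2)"
      using inverse_power_summable[of 2] by (subst summable_Suc_iff) (auto simp: inverse_eq_divide)
    then have "summable (\<lambda>n. 1 / (real n + 1)\<^sup>2)" by (simp add: add.commute)
    then show "summable (\<lambda>n. 2 * (1 / (real n + 1)\<^sup>2))" by (rule summable_mult)
    from small show "\<forall>\<^sub>F n in sequentially.
        noise_prob \<epsilon> (A n \<union> F n) (seq_prefix X n) \<le> 2 * (1 / (real n + 1)\<^sup>2)"
    proof eventually_elim
      case (elim n)
      have fin: "finite (A n)" "finite (F n)"
        using A[of n] by (auto intro!: finite_subset[OF _ finite_lists_length[of n]] simp: F_def)
      have "noise_prob \<epsilon> (A n \<union> F n) (seq_prefix X n)
          \<le> noise_prob \<epsilon> (A n) (seq_prefix X n) + noise_prob \<epsilon> (F n) (seq_prefix X n)"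
        unfolding noise_prob_def using fin flip_bounds
        by (subst sum_Un) (auto intro!: sum_nonneg noise_weight_nonneg)
      then show ?case using elim F[of n] by linarith
    qed
  qed
  then obtain Y where Y: "\<forall>\<^sub>F n in sequentially. seq_prefix Y n \<notin> A n \<union> F n" by blast
  define d where "d n = real (hamming (seq_prefix X n) (seq_prefix Y n)) / real n" for n
  have "(\<lambda>n. 2 * ((\<Sum>i<n. \<epsilon> i) / real n) + 2 * log 2 (real n + 1) / real n) \<longlonglongrightarrow> 2 * 0 + 0"
    by (intro tendsto_add tendsto_mult tendsto_const cesaro_mean_tendsto_zero assms(1) flip_bounds) real_asymp
  then have lim: "(\<lambda>n. 2 * ((\<Sum>i<n. \<epsilon> i) / real n) + 2 * log 2 (real n + 1) / real n) \<longlonglongrightarrow> 0" by simp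
  have "\<forall>\<^sub>F n in sequentially. norm (d n)
      \<le> 2 * ((\<Sum>i<n. \<epsilon> i) / real n) + 2 * log 2 (real n + 1) / real n"
    using Y
  proof eventually_elim
    case (elim n)
    then have "real (hamming (seq_prefix X n) (seq_prefix Y n)) \<le> r n" by (auto simp: F_def)
    then have "d n \<le> r n / real n" unfolding d_def by (rule divide_right_mono) simp
    then show ?case by (simp add: d_def r_def add_divide_distrib)
  qed
  then have "d \<longlonglongrightarrow> 0" using lim by (rule Lim_null_comparison)
  then have "(\<lambda>n. ereal (d n)) \<longlonglongrightarrow> 0" by (simp add: zero_ereal_def)
  then have "besicovitch_dist X Y = 0"
    unfolding besicovitch_dist_def d_def by (intro lim_imp_Limsup) auto
  moreover have "\<forall>\<^sub>F n in sequentially. seq_prefix Y n \<notin> A n"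
    using Y by (rule eventually_mono) auto
  ultimately show ?thesis by blast
qed

subsection \<open>Strings that noise makes simple\<close>

text \<open>
  The binary digits of \<open>b\<close> mark the exponents \<open>k\<close> such that the noise is reduced at position \<open>2 ^ k\<close>.
  The cap \<open>K\<close> keeps the noise bounded below for every \<open>b\<close>.
\<close>

definition denom :: "nat \<Rightarrow> nat \<Rightarrow> nat \<Rightarrow> nat" where
  "denom K b i = min K (2 + (\<Sum>k<i. of_bool (odd (b div 2 ^ k) \<and> 2 ^ k \<le> i)))"

definition flip_prob :: "nat \<Rightarrow> nat \<Rightarrow> nat \<Rightarrow> real" where
  "flip_prob K b i = 1 / real (denom K b i)"

definition simple_strings :: "(bool list \<rightharpoonup> bool list) \<Rightarrow> nat \<Rightarrow> nat \<Rightarrow> bool list set" where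
  "simple_strings U n s = {y. length y = n \<and> complexity U y < enat s}"

text \<open>The union over all candidate patterns \<open>b\<close> makes the set independent of the
  actual, possibly noncomputable, noise levels.\<close>

definition noisy_simple_strings :: "(bool list \<rightharpoonup> bool list) \<Rightarrow> nat \<Rightarrow> nat \<Rightarrow> nat \<Rightarrow> bool list set" where
  "noisy_simple_strings U K n s = {x. length x = n \<and>
     (\<exists>b<2 * n + 1. 1 / (real n + 1)\<^sup>2 \<le> noise_prob (flip_prob K b) (simple_strings U n s) x)}"

lemma denom_ge_2: "2 \<le> K \<Longrightarrow> 2 \<le> denom K b i" and denom_le: "denom K b i \<le> K"
  by (simp_all add: denom_def)

text \<open>The cap gives flip probability at least \<open>1 / K\<close>, and denominators of at
  least 2 give no-flip probability at least \<open>1 / 2\<close>; so \<open>1 / (2 * K)\<close> can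
  serve as \<open>\<eta>\<close>.\<close>

lemma flip_prob_bounds:
  assumes "2 \<le> K"
  shows "0 \<le> flip_prob K b i \<and> flip_prob K b i \<le> 1
    \<and> 1 / (2 * real K) \<le> flip_prob K b i * (1 - flip_prob K b i)"
proof -
  define d where "d = real (denom K b i)"
  have d: "2 \<le> d" "d \<le> real K"
    using denom_ge_2[OF assms, of b i] denom_le[of K b i] by (simp_all add: d_def)
  have "1 / (2 * real K) \<le> 1 / (2 * d)"
    using d by (intro divide_left_mono) auto
  also have "\<dots> = 1 / d * (1 / 2)" by simp
  also have "\<dots> \<le> 1 / d * (1 - 1 / d)"
    using d by (intro mult_left_mono) (auto simp: field_simps)
  finally show ?thesis using d by (simp add: flip_prob_def d_def[symmetric])
qed

text \<open>The codes of the strings shorter than \<open>s\<close> form an initial segment, so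
  bounds on program length become bounded quantifiers over codes.\<close>

lemma length_less_iff: "length p < s \<longleftrightarrow> Suc (str_code p) < 2 ^ s"
proof
  assume "length p < s"
  then have "(2::nat) ^ Suc (length p) \<le> 2 ^ s" by (intro power_increasing) auto
  with str_code_bounds(2)[of p] show "Suc (str_code p) < 2 ^ s" by (rule less_le_trans)
next
  assume "Suc (str_code p) < 2 ^ s"
  with str_code_bounds(1)[of p] have "(2::nat) ^ length p < 2 ^ s" by (rule le_less_trans)
  then show "length p < s" by (rule power_less_imp_less_exp[rotated]) simp
qed

section \<open>Counting simple and noisy simple strings\<close>

lemma finite_simple_strings: "finite (simple_strings U n s)"
  by (rule finite_subset[OF _ finite_lists_length[of n]]) (auto simp: simple_strings_def)

lemma card_simple_strings: "card (simple_strings U n s) \<le> 2 ^ s"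
proof -
  have "simple_strings U n s \<subseteq> (\<lambda>c. the (U (inv str_code c))) ` {..<2 ^ s}"
  proof
    fix y assume "y \<in> simple_strings U n s"
    then obtain p where p: "U p = Some y" "length p < s"
      by (auto simp: simple_strings_def complexity_less_iff)
    then have "str_code p < 2 ^ s" "the (U (inv str_code (str_code p))) = y"
      by (simp_all add: length_less_iff)
    then show "y \<in> (\<lambda>c. the (U (inv str_code c))) ` {..<2 ^ s}" by blast
  qed
  then have "card (simple_strings U n s) \<le> card ((\<lambda>c. the (U (inv str_code c))) ` {..<2 ^ s :: nat})"
    by (rule card_mono[rotated]) simp
  also have "\<dots> \<le> card {..<2 ^ s :: nat}" by (rule card_image_le) simp
  finally show ?thesis by simp
qed

lemma finite_noisy_simple_strings: "finite (noisy_simple_strings U K n s)"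
  by (rule finite_subset[OF _ finite_lists_length[of n]]) (auto simp: noisy_simple_strings_def)

text \<open>The factor \<open>2 * n + 1\<close> is the union bound over the patterns
  \<open>b\<close>, and \<open>(n + 1) ^ 4\<close> is the inverse square of the threshold.\<close>

lemma card_noisy_simple_strings:
  assumes "2 \<le> K"
  shows "real (card (noisy_simple_strings U K n s))
    \<le> (2 * real n + 1) * (real n + 1) ^ 4 * 2 powr (s * (1 + 1 / (2 * real K)) - n * (1 / (2 * real K)))"
proof -
  let ?\<eta> = "1 / (2 * real K)" and ?\<theta> = "1 / (real n + 1)\<^sup>2"
  let ?B = "\<lambda>b. {x. length x = n \<and> ?\<theta> \<le> noise_prob (flip_prob K b) (simple_strings U n s) x}"
  have B: "real (card (?B b)) \<le> (real n + 1) ^ 4 * 2 powr (s * (1 + ?\<eta>) - n * ?\<eta>)" for b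
  proof -
    have "real (card (simple_strings U n s)) \<le> 2 powr real s"
      using card_simple_strings[of U n s] by (simp add: powr_realpow flip: of_nat_le_iff)
    then have "real (card (?B b)) \<le> 2 powr (s * (1 + ?\<eta>) - n * ?\<eta>) / ?\<theta>\<^sup>2"
      using flip_prob_bounds[OF assms]
      by (intro card_noise_prob_ge) (auto simp: simple_strings_def)
    also have "\<dots> = (real n + 1) ^ 4 * 2 powr (s * (1 + ?\<eta>) - n * ?\<eta>)"
      by (simp add: power_divide power_mult[symmetric])
    finally show ?thesis .
  qed
  have "noisy_simple_strings U K n s = (\<Union>b<2 * n + 1. ?B b)"
    by (auto simp: noisy_simple_strings_def)
  then have "real (card (noisy_simple_strings U K n s)) \<le> (\<Sum>b<2 * n + 1. real (card (?B b)))"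
    using card_UN_le[of "{..<2 * n + 1}" ?B] by (simp flip: of_nat_sum)
  also have "\<dots> \<le> (\<Sum>b<2 * n + 1. (real n + 1) ^ 4 * 2 powr (s * (1 + ?\<eta>) - n * ?\<eta>))"
    by (intro sum_mono B)
  also have "\<dots> = (2 * real n + 1) * (real n + 1) ^ 4 * 2 powr (s * (1 + ?\<eta>) - n * ?\<eta>)"
    by simp
  finally show ?thesis .
qed

text \<open>\<open>Suc (str_code x)\<close> is the ordinary binary number with low digits
  \<open>x\<close>, least significant first, and a leading 1.\<close>

lemma odd_div_str_code: "i < length x \<Longrightarrow> odd (Suc (str_code x) div 2 ^ i) \<longleftrightarrow> x ! i"
proof (induction x arbitrary: i)
  case (Cons b x)
  have step: "Suc (str_code (b # x)) = of_bool b + 2 * Suc (str_code x)" by simp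
  show ?case
  proof (cases i)
    case 0
    then show ?thesis unfolding step by simp
  next
    case (Suc j)
    have "Suc (str_code (b # x)) div 2 ^ i = (of_bool b + 2 * Suc (str_code x)) div 2 div 2 ^ j"
      unfolding step Suc by (simp add: div_mult2_eq)
    also have "(of_bool b + 2 * Suc (str_code x)) div 2 = Suc (str_code x)"
      by (cases b) simp_all
    finally show ?thesis using Cons Suc by simp
  qed
qed simp

text \<open>\<open>noise_weight\<close> over the common denominator
  \<open>\<Prod>i<n. denom K b i\<close>: with \<open>d\<close> the denominator at a position,
  agreement has weight \<open>(d - 1) / d\<close> and a flip \<open>1 / d\<close>.\<close>

definition weight_numerator :: "nat \<Rightarrow> nat \<Rightarrow> nat \<Rightarrow> nat \<Rightarrow> nat \<Rightarrow> nat" where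
  "weight_numerator K b n c d =
     (\<Prod>i<n. if odd (Suc c div 2 ^ i) = odd (Suc d div 2 ^ i) then denom K b i - 1 else 1)"

lemma noise_weight_flip_prob:
  assumes "2 \<le> K" "length x = n" "length y = n"
  shows "noise_weight (flip_prob K b) x y
    = real (weight_numerator K b n (str_code x) (str_code y)) / real (\<Prod>i<n. denom K b i)"
proof -
  have "noise_weight (flip_prob K b) x y
      = (\<Prod>i<n. real (if odd (Suc (str_code x) div 2 ^ i) = odd (Suc (str_code y) div 2 ^ i)
          then denom K b i - 1 else 1) / real (denom K b i))"
    unfolding noise_weight_def assms(2)
  proof (intro prod.cong refl)
    fix i assume "i \<in> {..<n}"
    then have "odd (Suc (str_code x) div 2 ^ i) = odd (Suc (str_code y) div 2 ^ i) \<longleftrightarrow> x ! i = y ! i"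
      using assms by (simp only: odd_div_str_code lessThan_iff)
    then show "(if x ! i = y ! i then 1 - flip_prob K b i else flip_prob K b i)
        = real (if odd (Suc (str_code x) div 2 ^ i) = odd (Suc (str_code y) div 2 ^ i)
          then denom K b i - 1 else 1) / real (denom K b i)"
      using denom_ge_2[OF assms(1), of b i] by (simp add: flip_prob_def field_simps of_nat_diff)
  qed
  then show ?thesis by (simp add: weight_numerator_def prod_dividef)
qed

text \<open>
  \<open>S t p = Suc d\<close> means that the program with code \<open>p\<close> has produced the string with code \<open>d\<close> by stage \<open>t\<close>.
  The condition is \<open>1 / (n + 1)\<^sup>2 \<le> noise_prob \<dots>\<close> for the simple strings found so far, with denominators cleared.
\<close>

definition noisy_at_stage :: "(nat \<Rightarrow> nat \<Rightarrow> nat) \<Rightarrow> nat \<Rightarrow> nat \<Rightarrow> nat \<Rightarrow> nat \<Rightarrow> nat \<Rightarrow> bool" where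
  "noisy_at_stage S K n s c t \<longleftrightarrow> (\<exists>b<2 * n + 1. (\<Prod>i<n. denom K b i) \<le>
     (n + 1) * (n + 1) * (\<Sum>d<2 ^ Suc n. if code_length d = n \<and> (\<exists>p<2 ^ s. Suc p < 2 ^ s \<and> S t p = Suc d)
       then weight_numerator K b n c d else 0))"

lemma noisy_at_stage_iff:
  assumes "2 \<le> K" "length x = n"
  shows "noisy_at_stage S K n s (str_code x) t \<longleftrightarrow> (\<exists>b<2 * n + 1. 1 / (real n + 1)\<^sup>2
    \<le> noise_prob (flip_prob K b) {y. length y = n \<and> (\<exists>p. Suc p < 2 ^ s \<and> S t p = Suc (str_code y))} x)"
proof -
  let ?A = "{y. length y = n \<and> (\<exists>p. Suc p < 2 ^ s \<and> S t p = Suc (str_code y))}"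
  have "(\<Prod>i<n. denom K b i) \<le> (n + 1) * (n + 1) *
      (\<Sum>d<2 ^ Suc n. if code_length d = n \<and> (\<exists>p<2 ^ s. Suc p < 2 ^ s \<and> S t p = Suc d)
         then weight_numerator K b n (str_code x) d else 0)
    \<longleftrightarrow> 1 / (real n + 1)\<^sup>2 \<le> noise_prob (flip_prob K b) ?A x" for b
  proof -
    define P where "P = real (\<Prod>i<n. denom K b i)"
    have P: "P > 0"
      unfolding P_def using denom_ge_2[OF assms(1), of b] by (auto intro!: prod_pos) (metis not_less_eq_eq le0 numeral_2_eq_2 gr0I)
    define w where "w d = weight_numerator K b n (str_code x) d" for d
    \<comment> \<open>The bounded quantifier, which serves decidability, reaches every
      \<open>p\<close> with \<open>Suc p < 2 ^ s\<close>.\<close>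
    have p: "(\<exists>p<2 ^ s. Suc p < 2 ^ s \<and> S t p = Suc d) \<longleftrightarrow> (\<exists>p. Suc p < 2 ^ s \<and> S t p = Suc d)" for d
      using Suc_lessD by blast
    define Q where "Q d \<longleftrightarrow> (\<exists>p. Suc p < 2 ^ s \<and> S t p = Suc d)" for d
    have img: "str_code ` {y. length y = n \<and> Q (str_code y)} = {d\<in>{..<2 ^ Suc n}. code_length d = n \<and> Q d}"
    proof (intro equalityI subsetI)
      fix d assume "d \<in> str_code ` {y. length y = n \<and> Q (str_code y)}"
      then obtain y where y: "d = str_code y" "length y = n" "Q d" by blast
      from y(1,2) have "d < 2 ^ Suc n" "code_length d = n"
        using Suc_lessD[OF str_code_bounds(2)[of y]] by (simp_all only: code_length_str_code)
      with y(3) show "d \<in> {d\<in>{..<2 ^ Suc n}. code_length d = n \<and> Q d}" by blast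
    next
      fix d assume d: "d \<in> {d\<in>{..<2 ^ Suc n}. code_length d = n \<and> Q d}"
      then have "inv str_code d \<in> {y. length y = n \<and> Q (str_code y)}"
        using code_length_str_code[of "inv str_code d"] by simp
      then have "str_code (inv str_code d) \<in> str_code ` {y. length y = n \<and> Q (str_code y)}"
        by (rule imageI)
      then show "d \<in> str_code ` {y. length y = n \<and> Q (str_code y)}" by simp
    qed
    have "(\<Sum>d<2 ^ Suc n. if code_length d = n \<and> (\<exists>p<2 ^ s. Suc p < 2 ^ s \<and> S t p = Suc d)
        then w d else 0) = sum w (str_code ` ?A)"
      unfolding p Q_def[symmetric] img by (rule sum.inter_filter[symmetric]) simp
    also have "\<dots> = (\<Sum>y\<in>?A. w (str_code y))"
    proof -
      have "inj_on str_code ?A" by (simp add: inj_on_def)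
      then show ?thesis by (simp only: sum.reindex o_def)
    qed
    finally have sum: "(\<Sum>d<2 ^ Suc n. if code_length d = n \<and> (\<exists>p<2 ^ s. Suc p < 2 ^ s \<and> S t p = Suc d)
        then w d else 0) = (\<Sum>y\<in>?A. w (str_code y))" .
    have "noise_prob (flip_prob K b) ?A x = (\<Sum>y\<in>?A. real (w (str_code y)) / P)"
      unfolding noise_prob_def w_def P_def using assms
      by (intro sum.cong[OF refl] noise_weight_flip_prob) simp_all
    also have "\<dots> = real (\<Sum>y\<in>?A. w (str_code y)) / P"
      by (simp only: sum_divide_distrib of_nat_sum)
    finally have np: "noise_prob (flip_prob K b) ?A x = real (\<Sum>y\<in>?A. w (str_code y)) / P" .
    have "1 / (real n + 1)\<^sup>2 \<le> noise_prob (flip_prob K b) ?A x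
        \<longleftrightarrow> P \<le> (real n + 1)\<^sup>2 * real (\<Sum>y\<in>?A. w (str_code y))"
      unfolding np using P by (simp add: divide_simps mult.commute)
    also have "\<dots> \<longleftrightarrow> (\<Prod>i<n. denom K b i) \<le> (n + 1) * (n + 1) * (\<Sum>y\<in>?A. w (str_code y))"
    proof -
      have "(real n + 1)\<^sup>2 * real (\<Sum>y\<in>?A. w (str_code y))
          = real ((n + 1) * (n + 1) * (\<Sum>y\<in>?A. w (str_code y)))"
        by (simp only: of_nat_mult of_nat_add of_nat_1 power2_eq_square)
      then show ?thesis unfolding P_def by (simp only: of_nat_le_iff)
    qed
    finally show ?thesis unfolding sum[unfolded w_def] unfolding w_def by (rule sym)
  qed
  then show ?thesis unfolding noisy_at_stage_def by simp
qed

section \<open>Decidability of the stage condition\<close>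

lemma recursive_denom [recursive_intros]:
  assumes "recursive B" "recursive I"
  shows "recursive (\<lambda>e. denom K (B e) (I e))"
  unfolding denom_def using recursive_shift[OF assms(1), of 1] recursive_shift[OF assms(2), of 1] assms
  by (intro recursive_intros) auto

lemma recursive_weight_numerator [recursive_intros]:
  assumes "recursive B" "recursive N" "recursive C" "recursive D"
  shows "recursive (\<lambda>e. weight_numerator K (B e) (N e) (C e) (D e))"
  unfolding weight_numerator_def using assms recursive_shift[OF assms(1), of 1]
    recursive_shift[OF assms(3), of 1] recursive_shift[OF assms(4), of 1]
  by (intro recursive_intros) auto

lemma decidable_noisy_at_stage:
  assumes S: "\<And>A B. recursive A \<Longrightarrow> recursive B \<Longrightarrow> recursive (\<lambda>e. S (A e) (B e))"
    and NMCT: "recursive N" "recursive M" "recursive C" "recursive T"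
  shows "decidable (\<lambda>e. noisy_at_stage S K (N e) (M e) (C e) (T e))"
proof -
  \<comment> \<open>The parameters occur under up to three binders, for \<open>b\<close>,
    \<open>d\<close> and \<open>p\<close>.\<close>
  note shifts = NMCT NMCT[THEN recursive_shift, of 1] NMCT[THEN recursive_shift, of 2]
    NMCT[THEN recursive_shift, of 3]
  show ?thesis unfolding noisy_at_stage_def
    by (intro recursive_intros S) (use shifts in \<open>simp_all add: numeral_eq_Suc\<close>)
qed

text \<open>Half of the exponential decay absorbs the polynomial; the other half is a convergent
  geometric series.\<close>

lemma summable_poly_times_exp:
  fixes \<kappa> :: real
  assumes "\<kappa> > 0"
  shows "summable (\<lambda>n. (2 * real n + 1) * (real n + 1) ^ 4 * 2 powr (- \<kappa> * real n))"
proof (rule summable_comparison_test_bigo)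
  show "summable (\<lambda>n. norm ((2 powr (- \<kappa> / 2)) ^ n))"
    using assms by (simp add: norm_power powr_less_one)
  have "(\<lambda>n. (2 * real n + 1) * (real n + 1) ^ 4 * 2 powr (- \<kappa> * real n))
      \<in> O(\<lambda>n. 2 powr (- \<kappa> / 2 * real n))"
    using assms by real_asymp
  moreover have "2 powr (- \<kappa> / 2 * real n) = (2 powr (- \<kappa> / 2)) ^ n" for n
    by (subst powr_power) (auto simp: mult.commute)
  ultimately show "(\<lambda>n. (2 * real n + 1) * (real n + 1) ^ 4 * 2 powr (- \<kappa> * real n))
      \<in> O(\<lambda>n. (2 powr (- \<kappa> / 2)) ^ n)"
    by simp
qed

lemma real_div_bounds:
  assumes "0 < v"
  shows "real u / real v * real n - 1 < real (u * n div v)" "real (u * n div v) \<le> real u / real v * real n"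
proof -
  have "u * n < v + u * n div v * v" using assms by (rule dividend_less_div_times)
  then have "real u * real n < real v + real (u * n div v) * real v"
    by (metis of_nat_add of_nat_less_iff of_nat_mult)
  then show "real u / real v * real n - 1 < real (u * n div v)"
    using assms by (simp add: field_simps)
  have "u * n div v * v \<le> u * n" by (rule div_times_less_eq_dividend)
  then have "real (u * n div v) * real v \<le> real u * real n"
    by (metis of_nat_le_iff of_nat_mult)
  then show "real (u * n div v) \<le> real u / real v * real n"
    using assms by (simp add: field_simps)
qed

text \<open>The rational rate \<open>\<sigma> = u / v\<close> keeps the complexity threshold
  recursive in \<open>n\<close>. The resulting exponent per bit is
  \<open>\<sigma> - \<eta> * (1 - \<sigma>)\<close>, which is below \<open>\<sigma>\<close> when
  \<open>\<sigma> < 1\<close>.\<close>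

lemma card_noisy_simple_strings_ratio:
  assumes "2 \<le> K" "0 < v"
  defines "\<eta> \<equiv> 1 / (2 * real K)"
  shows "real (card (noisy_simple_strings U K n (u * n div v)))
    \<le> (2 * real n + 1) * (real n + 1) ^ 4 * 2 powr ((real u / real v * (1 + \<eta>) - \<eta>) * real n)"
proof -
  have "real (u * n div v) * (1 + \<eta>) \<le> (real u / real v * real n) * (1 + \<eta>)"
    by (intro mult_right_mono real_div_bounds assms) (simp add: \<eta>_def)
  then have "real (u * n div v) * (1 + \<eta>) - real n * \<eta> \<le> (real u / real v * (1 + \<eta>) - \<eta>) * real n"
    by (simp add: algebra_simps)
  then have "2 powr (real (u * n div v) * (1 + \<eta>) - real n * \<eta>)
      \<le> 2 powr ((real u / real v * (1 + \<eta>) - \<eta>) * real n)" by simp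
  then have "(2 * real n + 1) * (real n + 1) ^ 4 * 2 powr (real (u * n div v) * (1 + \<eta>) - real n * \<eta>)
      \<le> (2 * real n + 1) * (real n + 1) ^ 4 * 2 powr ((real u / real v * (1 + \<eta>) - \<eta>) * real n)"
    by (intro mult_left_mono) auto
  then show ?thesis
    using card_noisy_simple_strings[OF assms(1), of U n "u * n div v"] unfolding \<eta>_def by linarith
qed

text \<open>With a negative exponent the cardinality bound drops below 1. This covers dimension
  bounds \<open>\<gamma> \<le> 0\<close>, where complexity gives no contradiction.\<close>

lemma noisy_simple_strings_empty:
  assumes "2 \<le> K" "0 < v" and neg: "real u / real v * (1 + 1 / (2 * real K)) - 1 / (2 * real K) < 0"
  shows "\<forall>\<^sub>F n in sequentially. noisy_simple_strings U K n (u * n div v) = {}"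
proof -
  define \<kappa> where "\<kappa> = - (real u / real v * (1 + 1 / (2 * real K)) - 1 / (2 * real K))"
  have "\<kappa> > 0" using neg by (simp add: \<kappa>_def)
  then have "(\<lambda>n. (2 * real n + 1) * (real n + 1) ^ 4 * 2 powr (- \<kappa> * real n)) \<longlonglongrightarrow> 0"
    by (intro summable_LIMSEQ_zero summable_poly_times_exp)
  then have "\<forall>\<^sub>F n in sequentially. (2 * real n + 1) * (real n + 1) ^ 4 * 2 powr (- \<kappa> * real n) < 1"
    by (rule order_tendstoD) simp
  then show ?thesis
  proof eventually_elim
    case (elim n)
    have "real (card (noisy_simple_strings U K n (u * n div v))) < 1"
      using card_noisy_simple_strings_ratio[OF assms(1,2), of U n u] elim unfolding \<kappa>_def by simp
    then show ?case using finite_noisy_simple_strings by simp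
  qed
qed

text \<open>The noisy simple strings are enumerated in stages, length \<open>n\<close> being
  assigned to level \<open>u' * n div v' + c\<close>. The slack between the two rates makes their
  numbers, relative to \<open>2 ^ (u' * n div v')\<close>, summable over all lengths, so the strings
  of a level can be named by programs of that length.\<close>

lemma complexity_noisy_simple_strings:
  assumes U: "optimal U" and K: "2 \<le> K" and v: "0 < v" and u': "0 < u'" and v': "0 < v'"
    and rate: "real u / real v * (1 + 1 / (2 * real K)) - 1 / (2 * real K) < real u' / real v'"
  shows "\<exists>c. \<forall>n. \<forall>x \<in> noisy_simple_strings U K n (u * n div v). complexity U x \<le> enat (u' * n div v' + c)"
proof -
  define s where "s n = u * n div v" for n
  obtain f where f: "\<And>p x. U p = Some x \<longleftrightarrow> computes f [str_code p] (str_code x)"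
    using U unfolding optimal_def partial_computable_def by blast
  obtain E where E: "stagewise f 1 E" using stagewise_exists by blast
  define S where "S t p = E t [p]" for t p
  have S_rec: "recursive (\<lambda>e. S (A e) (B e))" if "recursive A" "recursive B" for A B
    using recursive_stagewise_subst[OF E that(1), of "\<lambda>_. B"] that(2) by (simp add: S_def)
  have S_sound: "U (inv str_code p) = Some y" if "S t p = Suc (str_code y)" for t p y
    using stagewise_sound[OF E, of "[p]" t "str_code y"] that by (simp add: S_def f)
  have S_complete: "\<exists>t. S t (str_code p) = Suc (str_code y)" if "U p = Some y" for p y
    using stagewise_complete[OF E, of "[str_code p]" "str_code y"] that by (simp add: S_def f)
  have S_mono: "S t' p = Suc y" if "S t p = Suc y" "t \<le> t'" for t t' p y
    using stagewise_mono[OF E, of t "[p]" y t'] that by (simp add: S_def)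
  define A where "A n t = {y. length y = n \<and> (\<exists>p. Suc p < 2 ^ s n \<and> S t p = Suc (str_code y))}" for n t
  have A_sub: "A n t \<subseteq> simple_strings U n (s n)" for n t
  proof
    fix y assume "y \<in> A n t"
    then obtain p where p: "length y = n" "Suc p < 2 ^ s n" "S t p = Suc (str_code y)" by (auto simp: A_def)
    then have "U (inv str_code p) = Some y" "length (inv str_code p) < s n"
      by (simp_all add: S_sound length_less_iff)
    then show "y \<in> simple_strings U n (s n)" using p(1) by (auto simp: simple_strings_def complexity_less_iff)
  qed
  \<comment> \<open>Finitely many strings are to be found, so a sum of their discovery stages serves
    them all.\<close>
  have A_eq: "\<exists>t. A n t = simple_strings U n (s n)" for n
  proof -
    have "\<forall>y\<in>simple_strings U n (s n). \<exists>t. \<exists>p. Suc p < 2 ^ s n \<and> S t p = Suc (str_code y)"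
    proof
      fix y assume "y \<in> simple_strings U n (s n)"
      then obtain p where "U p = Some y" "length p < s n"
        by (auto simp: simple_strings_def complexity_less_iff)
      then show "\<exists>t. \<exists>p. Suc p < 2 ^ s n \<and> S t p = Suc (str_code y)"
        using S_complete length_less_iff by blast
    qed
    then obtain t where t: "\<And>y. y \<in> simple_strings U n (s n) \<Longrightarrow>
        \<exists>p. Suc p < 2 ^ s n \<and> S (t y) p = Suc (str_code y)" by metis
    have "simple_strings U n (s n) \<subseteq> A n (sum t (simple_strings U n (s n)))"
    proof
      fix y assume y: "y \<in> simple_strings U n (s n)"
      then have "t y \<le> sum t (simple_strings U n (s n))"
        by (intro member_le_sum finite_simple_strings) auto
      moreover obtain p where "Suc p < 2 ^ s n" "S (t y) p = Suc (str_code y)" using t[OF y] by blast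
      ultimately show "y \<in> A n (sum t (simple_strings U n (s n)))"
        using y S_mono unfolding A_def simple_strings_def by blast
    qed
    then show ?thesis using A_sub by blast
  qed
  have noisy_iff: "x \<in> noisy_simple_strings U K n (s n) \<longleftrightarrow> (\<exists>t. noisy_at_stage S K n (s n) (str_code x) t)"
    if x: "length x = n" for x n
  proof
    assume "x \<in> noisy_simple_strings U K n (s n)"
    then obtain b where b: "b < 2 * n + 1"
      "1 / (real n + 1)\<^sup>2 \<le> noise_prob (flip_prob K b) (simple_strings U n (s n)) x"
      by (auto simp: noisy_simple_strings_def)
    obtain t where t: "A n t = simple_strings U n (s n)" using A_eq by blast
    show "\<exists>t. noisy_at_stage S K n (s n) (str_code x) t"
      using b unfolding t[symmetric] noisy_at_stage_iff[OF K x] A_def by blast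
  next
    assume "\<exists>t. noisy_at_stage S K n (s n) (str_code x) t"
    then obtain t b where "b < 2 * n + 1" "1 / (real n + 1)\<^sup>2 \<le> noise_prob (flip_prob K b) (A n t) x"
      unfolding noisy_at_stage_iff[OF K x] A_def by blast
    moreover have "noise_prob (flip_prob K b) (A n t) x \<le> noise_prob (flip_prob K b) (simple_strings U n (s n)) x"
      using flip_prob_bounds[OF K] by (intro noise_prob_mono A_sub finite_simple_strings) blast
    ultimately show "x \<in> noisy_simple_strings U K n (s n)"
      using x unfolding noisy_simple_strings_def by force
  qed
  define \<kappa> where "\<kappa> = real u' / real v' - (real u / real v * (1 + 1 / (2 * real K)) - 1 / (2 * real K))"
  define w where "w n = (2 * real n + 1) * (real n + 1) ^ 4 * 2 powr (- \<kappa> * real n)" for n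
  have w: "summable w" unfolding w_def using rate by (intro summable_poly_times_exp) (simp add: \<kappa>_def)
  have w_nonneg: "0 \<le> w n" for n by (simp add: w_def)
  have card_B: "real (card (noisy_simple_strings U K n (s n))) \<le> w n * (2 * 2 ^ (u' * n div v'))" for n
  proof -
    have "real (card (noisy_simple_strings U K n (s n)))
        \<le> (2 * real n + 1) * (real n + 1) ^ 4 * 2 powr ((real u / real v * (1 + 1 / (2 * real K)) - 1 / (2 * real K)) * real n)"
      unfolding s_def by (rule card_noisy_simple_strings_ratio[OF K v])
    also have "(real u / real v * (1 + 1 / (2 * real K)) - 1 / (2 * real K)) * real n
        = - \<kappa> * real n + real u' / real v' * real n"
      by (simp add: \<kappa>_def algebra_simps)
    also have "(2 * real n + 1) * (real n + 1) ^ 4 * 2 powr (- \<kappa> * real n + real u' / real v' * real n)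
        = w n * 2 powr (real u' / real v' * real n)"
      by (simp only: w_def powr_add mult.assoc)
    also have "\<dots> \<le> w n * 2 powr (1 + real (u' * n div v'))"
      using real_div_bounds(1)[OF v', of u' n] by (intro mult_left_mono w_nonneg) simp
    also have "\<dots> = w n * (2 * 2 ^ (u' * n div v'))"
      by (simp add: powr_add powr_realpow)
    finally show ?thesis .
  qed
  \<comment> \<open>The constant makes all lengths that share a level fit into \<open>2 ^ l\<close>
    programs; the factor 2 pays for rounding in \<open>u' * n div v'\<close>.\<close>
  obtain c where c: "2 * suminf w < 2 ^ c" using real_arch_pow[of 2 "2 * suminf w"] by auto
  define R where "R l d t \<longleftrightarrow> u' * code_length d div v' + c = l
      \<and> noisy_at_stage S K (code_length d) (s (code_length d)) d t" for l d t
  define F where "F l = {n. u' * n div v' + c = l}" for l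
  have F: "finite (F l)" for l
  proof (rule finite_subset)
    show "F l \<subseteq> {..Suc l * v'}"
    proof
      fix n assume "n \<in> F l"
      then have "u' * n div v' \<le> l" by (auto simp: F_def)
      have "n \<le> u' * n" using u' by simp
      also have "\<dots> < v' + u' * n div v' * v'" using v' by (rule dividend_less_div_times)
      also have "\<dots> \<le> v' + l * v'" using \<open>u' * n div v' \<le> l\<close> by simp
      finally show "n \<in> {..Suc l * v'}" by simp
    qed
  qed simp
  have R_sub: "{d. \<exists>t. R l d t} \<subseteq> str_code ` (\<Union>n\<in>F l. noisy_simple_strings U K n (s n))" for l
  proof
    fix d assume "d \<in> {d. \<exists>t. R l d t}"
    then obtain t where t: "R l d t" by blast
    define x where "x = inv str_code d"
    have d: "d = str_code x" by (simp add: x_def)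
    from t have "length x \<in> F l" "x \<in> noisy_simple_strings U K (length x) (s (length x))"
      using noisy_iff[of x "length x"] by (auto simp: R_def F_def d)
    then show "d \<in> str_code ` (\<Union>n\<in>F l. noisy_simple_strings U K n (s n))" unfolding d by blast
  qed
  have fin: "finite (\<Union>n\<in>F l. noisy_simple_strings U K n (s n))" for l
    using F finite_noisy_simple_strings by blast
  have "\<exists>V. partial_computable V \<and> (\<forall>l x t. R l (str_code x) t \<longrightarrow> complexity V x \<le> enat l)"
  proof (rule complexity_enumeration)
    show "decidable (\<lambda>e. R (e 0) (e 1) (e 2))"
      unfolding R_def s_def by (intro recursive_intros decidable_noisy_at_stage S_rec)
    show "finite {d. \<exists>t. R l d t}" for l
      using R_sub fin by (rule finite_subset[OF _ finite_imageI])
    show "card {d. \<exists>t. R l d t} \<le> 2 ^ l" for l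
    proof -
      have "card {d. \<exists>t. R l d t} \<le> card (str_code ` (\<Union>n\<in>F l. noisy_simple_strings U K n (s n)))"
        by (intro card_mono finite_imageI fin R_sub)
      also have "\<dots> \<le> card (\<Union>n\<in>F l. noisy_simple_strings U K n (s n))"
        by (intro card_image_le fin)
      also have "\<dots> \<le> (\<Sum>n\<in>F l. card (noisy_simple_strings U K n (s n)))"
        by (intro card_UN_le F)
      finally have "real (card {d. \<exists>t. R l d t}) \<le> real (\<Sum>n\<in>F l. card (noisy_simple_strings U K n (s n)))"
        by (simp only: of_nat_le_iff)
      also have "\<dots> = (\<Sum>n\<in>F l. real (card (noisy_simple_strings U K n (s n))))"
        by (rule of_nat_sum)
      also have "\<dots> \<le> (\<Sum>n\<in>F l. w n * (2 * 2 ^ l / 2 ^ c))"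
      proof (rule sum_mono)
        fix n assume "n \<in> F l"
        then have "(2::real) ^ l = 2 ^ (u' * n div v') * 2 ^ c" by (auto simp: F_def power_add)
        then show "real (card (noisy_simple_strings U K n (s n))) \<le> w n * (2 * 2 ^ l / 2 ^ c)"
          using card_B[of n] by simp
      qed
      also have "\<dots> = (\<Sum>n\<in>F l. w n) * (2 * 2 ^ l / 2 ^ c)" by (rule sum_distrib_right[symmetric])
      also have "\<dots> \<le> suminf w * (2 * 2 ^ l / 2 ^ c)"
        using w w_nonneg F by (intro mult_right_mono sum_le_suminf) auto
      also have "\<dots> = (2 * suminf w / 2 ^ c) * 2 ^ l" by simp
      also have "\<dots> \<le> 1 * 2 ^ l" using c by (intro mult_right_mono) (auto simp: divide_le_eq)
      finally have "real (card {d. \<exists>t. R l d t}) \<le> real (2 ^ l)" by simp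
      then show ?thesis by (simp only: of_nat_le_iff)
    qed
  qed
  then obtain V where V: "partial_computable V" "\<And>l x t. R l (str_code x) t \<Longrightarrow> complexity V x \<le> enat l"
    by blast
  obtain c' where c': "\<And>x. complexity U x \<le> complexity V x + enat c'"
    using U V(1) unfolding optimal_def by blast
  have "complexity U x \<le> enat (u' * n div v' + (c + c'))" if x: "x \<in> noisy_simple_strings U K n (s n)" for n x
  proof -
    have len: "length x = n" using x by (simp add: noisy_simple_strings_def)
    then obtain t where "noisy_at_stage S K n (s n) (str_code x) t" using x noisy_iff by blast
    then have "complexity V x \<le> enat (u' * n div v' + c)" by (intro V(2)[of _ _ t]) (simp add: R_def len)
    then have "complexity V x + enat c' \<le> enat (u' * n div v' + c) + enat c'" by (rule add_right_mono)
    then show ?thesis using c'[of x] by (simp add: add.assoc)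
  qed
  then show ?thesis unfolding s_def by blast
qed

subsection \<open>Noise of slowly decaying intensity\<close>

lemma nat_ratio_between:
  fixes a b :: real
  assumes "0 \<le> a" "a < b"
  shows "\<exists>u v :: nat. 0 < u \<and> 0 < v \<and> a < real u / real v \<and> real u / real v < b"
proof -
  obtain q where q: "q \<in> \<rat>" "a < q" "q < b" using Rats_dense_in_real[OF assms(2)] by blast
  obtain u v :: nat where "v \<noteq> 0" "\<bar>q\<bar> = real u / real v" using q(1) by (rule Rats_abs_nat_div_natE)
  moreover have "\<bar>q\<bar> = q" "q > 0" using assms q by auto
  ultimately have "0 < v" "q = real u / real v" "0 < u" by (auto intro: gr0I)
  then show ?thesis using q by blast
qed

text \<open>The lower limit exceeds the midpoint \<open>\<tau>'\<close> of \<open>\<tau>\<close> and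
  \<open>\<gamma>\<close>, and the gap times \<open>n\<close> eventually absorbs \<open>c\<close>.
  Quantifying over upper bounds \<open>k\<close> also covers infinite complexity.\<close>

lemma eventually_complexity_gt:
  assumes dim: "effective_dim U X \<ge> ereal \<gamma>" and \<tau>: "\<tau> < \<gamma>"
  shows "\<forall>\<^sub>F n in sequentially. \<forall>k. complexity U (seq_prefix X n) \<le> enat k \<longrightarrow> \<tau> * real n + c < real k"
proof -
  define \<tau>' where "\<tau>' = (\<tau> + \<gamma>) / 2"
  have \<tau>': "\<tau> < \<tau>'" "\<tau>' < \<gamma>" using \<tau> by (simp_all add: \<tau>'_def)
  then have "ereal \<tau>' < effective_dim U X" using dim by (meson ereal_less_le less_ereal.simps(1) less_le_trans)
  then have "\<forall>\<^sub>F n in sequentially. ereal \<tau>' < ereal_of_enat (complexity U (seq_prefix X n)) / ereal (real n)"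
    unfolding effective_dim_def by (rule less_LiminfD)
  moreover have "\<forall>\<^sub>F n in sequentially. \<bar>c\<bar> / (\<tau>' - \<tau>) + 1 \<le> real n"
    by real_asymp
  ultimately show ?thesis
  proof eventually_elim
    case (elim n)
    have "0 \<le> \<bar>c\<bar> / (\<tau>' - \<tau>)" using \<tau>' by simp
    then have n: "real n > 0" using elim(2) by linarith
    have "\<bar>c\<bar> / (\<tau>' - \<tau>) < real n" using elim(2) by linarith
    then have c: "c < (\<tau>' - \<tau>) * real n" using \<tau>' by (simp add: pos_divide_less_eq mult.commute)
    show ?case
    proof (intro allI impI)
      fix k assume "complexity U (seq_prefix X n) \<le> enat k"
      then obtain j where j: "complexity U (seq_prefix X n) = enat j" "j \<le> k"
        by (cases "complexity U (seq_prefix X n)") auto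
      then have "\<tau>' < real j / real n" using elim(1) n by simp
      then have "\<tau>' * real n < real j" using n by (simp add: pos_less_divide_eq)
      also have "\<dots> \<le> real k" using j by simp
      finally show "\<tau> * real n + c < real k" using c by (simp add: algebra_simps)
    qed
  qed
qed

text \<open>For a fixed cap the bound holds uniformly in \<open>b\<close>: a prefix violating it
  would be a noisy simple string, too simple for the dimension of \<open>X\<close> or, for
  \<open>\<gamma> \<le> 0\<close>, nonexistent.\<close>

lemma eventually_noise_prob_small:
  assumes U: "optimal U" and \<gamma>: "\<gamma> < 1" and dim: "effective_dim U X \<ge> ereal \<gamma>"
    and \<delta>: "\<delta> \<longlonglongrightarrow> 0" and K: "2 \<le> K"
  shows "\<forall>\<^sub>F n in sequentially. \<forall>b<2 * n + 1. noise_prob (flip_prob K b)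
    {y. length y = n \<and> ereal_of_enat (complexity U y) < ereal (real n * (\<gamma> + \<delta> n))} (seq_prefix X n)
      < 1 / (real n + 1)\<^sup>2"
proof -
  define \<eta> where "\<eta> = 1 / (2 * real K)"
  define \<gamma>\<^sub>0 where "\<gamma>\<^sub>0 = max \<gamma> 0"
  have \<eta>: "\<eta> > 0" using K by (simp add: \<eta>_def)
  have \<gamma>\<^sub>0: "0 \<le> \<gamma>\<^sub>0" "\<gamma>\<^sub>0 < 1" "\<gamma> \<le> \<gamma>\<^sub>0" using \<gamma> by (auto simp: \<gamma>\<^sub>0_def)
  \<comment> \<open>The right side solves
    \<open>\<sigma> * (1 + \<eta>) - \<eta> = \<gamma>\<^sub>0\<close>. A rate strictly between
    therefore exceeds \<open>\<gamma>\<^sub>0\<close>, while noise brings its exponent below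
    \<open>\<gamma>\<^sub>0\<close>.\<close>
  have "\<gamma>\<^sub>0 < (\<gamma>\<^sub>0 + \<eta>) / (1 + \<eta>)" using \<eta> \<gamma>\<^sub>0 by (simp add: field_simps)
  then obtain u v :: nat where v: "0 < v" and \<sigma>: "\<gamma>\<^sub>0 < real u / real v" "real u / real v < (\<gamma>\<^sub>0 + \<eta>) / (1 + \<eta>)"
    using nat_ratio_between[OF \<gamma>\<^sub>0(1)] by blast
  have rate: "real u / real v * (1 + \<eta>) - \<eta> < \<gamma>\<^sub>0"
    using \<sigma>(2) \<eta> by (simp add: pos_less_divide_eq)
  have outside: "\<forall>\<^sub>F n in sequentially. seq_prefix X n \<notin> noisy_simple_strings U K n (u * n div v)"
  proof (cases "\<gamma> > 0")
    case True
    then have "\<gamma>\<^sub>0 = \<gamma>" by (simp add: \<gamma>\<^sub>0_def)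
    then have "max 0 (real u / real v * (1 + \<eta>) - \<eta>) < \<gamma>" using True rate by simp
    then obtain u' v' :: nat where *: "0 < u'" "0 < v'"
      "max 0 (real u / real v * (1 + \<eta>) - \<eta>) < real u' / real v'" "real u' / real v' < \<gamma>"
      using nat_ratio_between[of "max 0 (real u / real v * (1 + \<eta>) - \<eta>)" \<gamma>] by auto
    then obtain c where c: "\<And>n x. x \<in> noisy_simple_strings U K n (u * n div v) \<Longrightarrow>
        complexity U x \<le> enat (u' * n div v' + c)"
      using complexity_noisy_simple_strings[OF U K v *(1,2), of u] unfolding \<eta>_def by auto
    from eventually_complexity_gt[OF dim *(4), of "real c"] show ?thesis
    proof eventually_elim
      case (elim n)
      show ?case
      proof
        assume "seq_prefix X n \<in> noisy_simple_strings U K n (u * n div v)"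
        from elim[rule_format, OF c[OF this]] real_div_bounds(2)[OF *(2), of u' n] show False by simp
      qed
    qed
  next
    case False
    then have "real u / real v * (1 + \<eta>) - \<eta> < 0" using rate by (simp add: \<gamma>\<^sub>0_def)
    from noisy_simple_strings_empty[OF K v this[unfolded \<eta>_def], of U] show ?thesis
      by (rule eventually_mono) auto
  qed
  \<comment> \<open>Half of the gap dominates \<open>\<delta> n\<close>; the other half, times
    \<open>n\<close>, pays for rounding in \<open>u * n div v\<close>.\<close>
  define \<kappa> where "\<kappa> = (real u / real v - \<gamma>\<^sub>0) / 2"
  have \<kappa>: "\<kappa> > 0" using \<sigma>(1) by (simp add: \<kappa>_def)
  have "\<forall>\<^sub>F n in sequentially. \<delta> n < \<kappa>" using order_tendstoD(2)[OF \<delta> \<kappa>] .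
  moreover have "\<forall>\<^sub>F n in sequentially. 1 / \<kappa> \<le> real n" by real_asymp
  ultimately show ?thesis using outside
  proof eventually_elim
    case (elim n)
    let ?L = "{y. length y = n \<and> ereal_of_enat (complexity U y) < ereal (real n * (\<gamma> + \<delta> n))}"
    have "real n * (\<gamma> + \<delta> n) \<le> real n * (\<gamma>\<^sub>0 + \<kappa>)"
      using elim(1) \<gamma>\<^sub>0(3) by (intro mult_left_mono) auto
    also have "\<dots> = real u / real v * real n - \<kappa> * real n" by (simp add: \<kappa>_def algebra_simps)
    also have "\<dots> \<le> real u / real v * real n - 1"
      using elim(2) \<kappa> by (simp add: pos_divide_le_eq mult.commute)
    also have "\<dots> \<le> real (u * n div v)" using real_div_bounds(1)[OF v, of u n] by simp
    finally have le: "real n * (\<gamma> + \<delta> n) \<le> real (u * n div v)" .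
    have "?L \<subseteq> simple_strings U n (u * n div v)"
    proof
      fix y assume y: "y \<in> ?L"
      then have "ereal_of_enat (complexity U y) < ereal (real (u * n div v))"
        using le by (auto intro: less_le_trans)
      then have "complexity U y < enat (u * n div v)" by (cases "complexity U y") auto
      then show "y \<in> simple_strings U n (u * n div v)" using y by (simp add: simple_strings_def)
    qed
    then have "noise_prob (flip_prob K b) ?L (seq_prefix X n)
        \<le> noise_prob (flip_prob K b) (simple_strings U n (u * n div v)) (seq_prefix X n)" for b
      using flip_prob_bounds[OF K] by (intro noise_prob_mono finite_simple_strings) auto
    moreover have "noise_prob (flip_prob K b) (simple_strings U n (u * n div v)) (seq_prefix X n)
        < 1 / (real n + 1)\<^sup>2" if "b < 2 * n + 1" for b
      using elim(3) that unfolding noisy_simple_strings_def by (simp add: not_le)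
    ultimately show ?case by (blast intro: le_less_trans)
  qed
qed

lemma noise_prob_cong:
  assumes "\<And>i. i < length x \<Longrightarrow> \<epsilon> i = \<epsilon>' i"
  shows "noise_prob \<epsilon> A x = noise_prob \<epsilon>' A x"
  unfolding noise_prob_def noise_weight_def using assms by (intro sum.cong prod.cong) auto

lemma set_encode_less:
  assumes "A \<subseteq> {..<k}"
  shows "set_encode A < 2 ^ k"
proof -
  have "set_encode A \<le> (\<Sum>i<k. 2 ^ i)"
    unfolding set_encode_def using assms by (intro sum_mono2) auto
  also have "\<dots> < 2 ^ k" using sum_power2[of k] by (simp add: lessThan_atLeast0)
  finally show ?thesis .
qed

text \<open>The noise level may decay arbitrarily slowly: it drops only at positions \<open>2 ^ h l\<close> for a sparse sequence \<open>h\<close>,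
  so that the levels below \<open>n\<close> are described by a number below \<open>2 * n + 1\<close>.\<close>

lemma denom_set_encode:
  fixes h :: "nat \<Rightarrow> nat"
  assumes h: "strict_mono h" and n: "2 ^ h 0 \<le> n"
  shows "\<exists>m b. 2 ^ h m \<le> n \<and> b < 2 * n + 1 \<and> (\<forall>i\<le>n. denom (m + 3) b i = 2 + card {l. 2 ^ h l \<le> i})"
proof -
  have bound: "l < 2 ^ h l" for l
    using strict_mono_imp_increasing[OF h, of l] less_exp[of "h l"] by linarith
  have mono: "2 ^ h k \<le> (2::nat) ^ h l" if "k \<le> l" for k l
    using that by (intro power_increasing) (auto simp: strict_mono_less_eq[OF h])
  have le_n: "l \<le> n" if "2 ^ h l \<le> n" for l
    using bound[of l] that by linarith
  \<comment> \<open>\<open>2 ^ h m\<close> is the last drop position up to \<open>n\<close>.\<close>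
  define m where "m = (GREATEST m. 2 ^ h m \<le> n)"
  have m: "2 ^ h m \<le> n"
    unfolding m_def by (rule GreatestI_nat[of _ 0 n]) (use n le_n in auto)
  have m_max: "l \<le> m" if "2 ^ h l \<le> n" for l
    unfolding m_def by (rule Greatest_le_nat[of _ _ n]) (use that le_n in auto)
  \<comment> \<open>The marked exponents are \<open>h 0\<close> to \<open>h m\<close>, so
    \<open>b < 2 ^ Suc (h m) \<le> 2 * n\<close>.\<close>
  define b where "b = set_encode (h ` {..m})"
  have "b < 2 ^ Suc (h m)"
    unfolding b_def by (rule set_encode_less) (auto simp: less_Suc_eq_le strict_mono_less_eq[OF h])
  then have b: "b < 2 * n + 1" using m by simp
  have bit: "odd (b div 2 ^ k) \<longleftrightarrow> k \<in> h ` {..m}" for k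
  proof -
    have "set_decode b = h ` {..m}" unfolding b_def by (rule set_encode_inverse) simp
    then show ?thesis unfolding set_decode_def by blast
  qed
  \<comment> \<open>The cap has no effect here: at most \<open>m + 1\<close> drops occur up to
    \<open>n\<close>, so the uncapped value is at most \<open>m + 3\<close>.\<close>
  have "denom (m + 3) b i = 2 + card {l. 2 ^ h l \<le> i}" if i: "i \<le> n" for i
  proof -
    have sub: "{l. 2 ^ h l \<le> i} \<subseteq> {..m}" using i m_max by (auto intro: le_trans)
    have "{k\<in>{..<i}. odd (b div 2 ^ k) \<and> 2 ^ k \<le> i} = h ` {l. 2 ^ h l \<le> i}"
    proof (intro equalityI subsetI)
      fix k assume "k \<in> h ` {l. 2 ^ h l \<le> i}"
      then obtain l where l: "k = h l" "2 ^ h l \<le> i" by blast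
      moreover have "k < i" using less_le_trans[OF less_exp l(2)] l(1) by simp
      ultimately show "k \<in> {k\<in>{..<i}. odd (b div 2 ^ k) \<and> 2 ^ k \<le> i}"
        unfolding bit using sub by blast
    next
      fix k assume "k \<in> {k\<in>{..<i}. odd (b div 2 ^ k) \<and> 2 ^ k \<le> i}"
      then show "k \<in> h ` {l. 2 ^ h l \<le> i}" unfolding bit by blast
    qed
    moreover have "card (h ` {l. 2 ^ h l \<le> i}) = card {l. 2 ^ h l \<le> i}"
      using strict_mono_imp_inj_on[OF h] by (intro card_image) (auto intro: inj_on_subset)
    moreover have "(\<Sum>k<i. of_bool (odd (b div 2 ^ k) \<and> 2 ^ k \<le> i))
        = card {k\<in>{..<i}. odd (b div 2 ^ k) \<and> 2 ^ k \<le> i}"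
      by (simp only: sum_of_bool_eq finite_lessThan Int_def mem_Collect_eq of_nat_id)
    moreover have "card {l. 2 ^ h l \<le> i} \<le> Suc m"
      using card_mono[OF _ sub] by simp
    ultimately show ?thesis unfolding denom_def by simp
  qed
  with m b show ?thesis by blast
qed

lemma inverse_count_tendsto_zero:
  fixes h :: "nat \<Rightarrow> nat"
  assumes h: "strict_mono h"
  shows "(\<lambda>i :: nat. 1 / real (2 + card {l. 2 ^ h l \<le> i})) \<longlonglongrightarrow> 0"
proof -
  have fin: "finite {l. 2 ^ h l \<le> i}" for i :: nat
  proof (rule finite_subset)
    show "{l. 2 ^ h l \<le> i} \<subseteq> {..i}"
    proof
      fix l assume "l \<in> {l. 2 ^ h l \<le> i}"
      then show "l \<in> {..i}"
        using strict_mono_imp_increasing[OF h, of l] less_le_trans[OF less_exp, of "h l" i] by simp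
    qed
  qed simp
  have "filterlim (\<lambda>i :: nat. 2 + card {l. 2 ^ h l \<le> i}) at_top sequentially"
    unfolding filterlim_at_top
  proof
    fix k
    show "\<forall>\<^sub>F i in sequentially. k \<le> 2 + card {l. 2 ^ h l \<le> (i :: nat)}"
      using eventually_ge_at_top[of "2 ^ h k"]
    proof eventually_elim
      case (elim i)
      have "2 ^ h l \<le> i" if "l < k" for l
      proof -
        have "(2::nat) ^ h l \<le> 2 ^ h k"
          using that by (intro power_increasing) (auto simp: strict_mono_less_eq[OF h])
        then show ?thesis using elim by linarith
      qed
      then have "card {..<k} \<le> card {l. 2 ^ h l \<le> i}" by (intro card_mono fin) auto
      then show ?case by simp
    qed
  qed
  then have "filterlim (\<lambda>i :: nat. real (2 + card {l. 2 ^ h l \<le> i})) at_top sequentially"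
    by (rule filterlim_compose[OF filterlim_real_sequentially])
  then have "(\<lambda>i :: nat. inverse (real (2 + card {l. 2 ^ h l \<le> i}))) \<longlonglongrightarrow> 0"
    by (rule tendsto_inverse_0_at_top)
  then show ?thesis by (simp only: inverse_eq_divide)
qed

theorem theorem4:
  fixes U :: "bool list \<rightharpoonup> bool list"
    and \<gamma> :: real
    and X :: "nat \<Rightarrow> bool"
    and \<delta> :: "nat \<Rightarrow> real"
  assumes "optimal U"
    and "\<gamma> < 1"
    and "effective_dim U X \<ge> ereal \<gamma>"
    and "\<And>n. n \<ge> 1 \<Longrightarrow> \<delta> n > 0"
    and "\<delta> \<longlonglongrightarrow> 0"
  shows "\<exists>X' :: nat \<Rightarrow> bool.
           besicovitch_dist X X' = 0 \<and>
           (\<forall>\<^sub>F n in sequentially.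
              ereal_of_enat (complexity U (seq_prefix X' n)) \<ge> ereal (real n * (\<gamma> + \<delta> n)))"
proof -
  define L where "L n = {y. length y = n \<and> ereal_of_enat (complexity U y) < ereal (real n * (\<gamma> + \<delta> n))}" for n
  have "\<forall>K. \<exists>N. 2 \<le> K \<longrightarrow> (\<forall>n\<ge>N. \<forall>b<2 * n + 1.
      noise_prob (flip_prob K b) (L n) (seq_prefix X n) < 1 / (real n + 1)\<^sup>2)"
    \<comment> \<open>This fixes, for each cap \<open>K\<close>, a length \<open>N K\<close> beyond
      which noise with that cap is safe.\<close>
    using eventually_noise_prob_small[OF assms(1-3,5)] unfolding L_def eventually_sequentially by blast
  then obtain N where N: "\<And>K n b. 2 \<le> K \<Longrightarrow> N K \<le> n \<Longrightarrow> b < 2 * n + 1 \<Longrightarrow>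
      noise_prob (flip_prob K b) (L n) (seq_prefix X n) < 1 / (real n + 1)\<^sup>2" by metis
  \<comment> \<open>The summand \<open>l\<close> makes \<open>h\<close> strictly increasing, and the
    sum gives \<open>N (l + 3) \<le> h l\<close>: the denominator reaches \<open>l + 3\<close> only
    at lengths where that cap is already safe.\<close>
  define h where "h l = l + (\<Sum>k\<le>l + 3. N k)" for l
  have h: "strict_mono h" by (rule strict_monoI_Suc) (simp add: h_def numeral_eq_Suc)
  have N_le: "N (m + 3) \<le> 2 ^ h m" for m
  proof -
    have "N (m + 3) \<le> (\<Sum>k\<le>m + 3. N k)" by (intro member_le_sum) auto
    then have "N (m + 3) \<le> h m" by (simp add: h_def)
    then show ?thesis using less_exp[of "h m"] by linarith
  qed
  define \<epsilon> where "\<epsilon> i = 1 / real (2 + card {l. 2 ^ h l \<le> i})" for i :: nat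
  have "\<exists>Y. (\<forall>\<^sub>F n in sequentially. seq_prefix Y n \<notin> L n) \<and> besicovitch_dist X Y = 0"
  proof (rule bit_noise.noisy_sequence_exists)
    show "bit_noise \<epsilon>" by unfold_locales (simp add: \<epsilon>_def)
    show "\<epsilon> \<longlonglongrightarrow> 0" unfolding \<epsilon>_def by (rule inverse_count_tendsto_zero[OF h])
    show "L n \<subseteq> {y. length y = n}" for n by (auto simp: L_def)
    show "\<forall>\<^sub>F n in sequentially. noise_prob \<epsilon> (L n) (seq_prefix X n) \<le> 1 / (real n + 1)\<^sup>2"
      using eventually_ge_at_top[of "2 ^ h 0"]
    proof eventually_elim
      case (elim n)
      then obtain m b where m: "2 ^ h m \<le> n" and b: "b < 2 * n + 1"
        and denom: "\<And>i. i \<le> n \<Longrightarrow> denom (m + 3) b i = 2 + card {l. 2 ^ h l \<le> i}"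
        using denom_set_encode[OF h] by blast
      \<comment> \<open>Only the noise levels below \<open>n\<close> matter, and there the actual
        levels coincide with the pattern \<open>b\<close> under the cap
        \<open>m + 3\<close>.\<close>
      have "noise_prob \<epsilon> (L n) (seq_prefix X n) = noise_prob (flip_prob (m + 3) b) (L n) (seq_prefix X n)"
        by (rule noise_prob_cong) (simp add: \<epsilon>_def flip_prob_def denom)
      also have "\<dots> < 1 / (real n + 1)\<^sup>2" using N_le[of m] m b by (intro N) auto
      finally show ?case by simp
    qed
  qed
  then obtain Y where Y: "\<forall>\<^sub>F n in sequentially. seq_prefix Y n \<notin> L n" "besicovitch_dist X Y = 0" by blast
  from Y(1) have "\<forall>\<^sub>F n in sequentially.
      ereal_of_enat (complexity U (seq_prefix Y n)) \<ge> ereal (real n * (\<gamma> + \<delta> n))"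
    by (rule eventually_mono) (simp add: L_def not_less)
  with Y(2) show ?thesis by blast
qed

end
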